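(* Let $M$ be a connected closed $3$-dimensional manifold with a triangulation $\mathcal{T}=\{V,E,F,T\}$. (1) A Euclidean sphere packing metric on $(M,\mathcal{T})$ is determined by its combinatorial scalar curvature $K:V\to\mathbb{R}$ up to scaling. That is, if $r,r':V\to(0,+\infty)$ are two Euclidean sphere packing metrics on $(M,\mathcal{T})$ with $K_i(r)=K_i(r')$ for all $i\in V$, then there is a constant $c>0$ with $r'_i=c\,r_i$ for all $i\in V$. (2) A hyperbolic sphere packing metric on $(M,\mathcal{T})$ is determined by its combinatorial scalar curvature $K:V\to\mathbb{R}$. That is, if $r,r':V\to(0,+\infty)$ are two hyperbolic sphere packing metrics on $(M,\mathcal{T})$ with $K_i(r)=K_i(r')$ for all $i\in V$, then $r=r'$.
   Context: $V,E,F,T$ denote the (finite) sets of vertices, edges, faces and tetrahedra of the triangulation $\mathcal{T}$. A Euclidean (respectively hyperbolic) sphere packing metric on $(M,\mathcal{T})$ is a map $r:V\to(0,+\infty)$ such that, assigning to each edge $\{ij\}\in E$ the length $l_{ij}=r_i+r_j$, for each tetrahedron $\{i,j,k,l\}\in T$ the six numbers $l_{ij},l_{ik},l_{il},l_{jk},l_{jl},l_{kl}$ are the edge lengths of a nondegenerate Euclidean (respectively hyperbolic, curvature $-1$) tetrahedron. For a sphere packing metric $r$, the combinatorial scalar curvature $K:V\to\mathbb{R}$ is $$K_i=4\pi-\sum_{\{i,j,k,l\}\in T}\alpha_{ijkl},$$ where $\alpha_{ijkl}$ is the solid angle at the vertex $i$ of the (Euclidean, respectively hyperbolic) tetrahedron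 with vertices $i,j,k,l$ and the edge lengths above, and the sum is over all tetrahedra of $T$ having $i$ as a vertex. The solid angle at a vertex is the area of the corresponding spherical triangle on the unit sphere, i.e. the sum of the three dihedral angles at the edges meeting at that vertex minus $\pi$. *)

theory Defs
  imports "HOL-Analysis.Analysis"
begin

section \<open>Triangulated closed 3-manifolds\<close>

text \<open>Closed means compact and without boundary.\<close>

definition closed_3_manifold :: "'m topology \<Rightarrow> bool" where
  "closed_3_manifold M \<longleftrightarrow>
     Hausdorff_space M \<and> second_countable M \<and> compact_space M \<and>
     (\<forall>x \<in> topspace M. \<exists>U (B :: (real^3) set).
        openin M U \<and> x \<in> U \<and> open B \<and> subtopology M U homeomorphic_space top_of_set B)"

text \<open>A (finite) geometric simplicial complex together with a homeomorphism from its polyhedron.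
  The ambient Euclidean space of the complex only serves to realise it; its metric is never used
  below.\<close>

definition triangulates :: "'v::euclidean_space set set \<Rightarrow> ('v \<Rightarrow> 'm) \<Rightarrow> 'm topology \<Rightarrow> bool" where
  "triangulates C h M \<longleftrightarrow> simplicial_complex C \<and> homeomorphic_map (top_of_set (\<Union>C)) M h"

definition vertices :: "'v::euclidean_space set set \<Rightarrow> 'v set" where
  "vertices C = {v. {v} \<in> C}"

text \<open>Each tetrahedron is represented by the set of its four vertices.\<close>

definition tetrahedra :: "'v::euclidean_space set set \<Rightarrow> 'v set set" where
  "tetrahedra C = {{v. v extreme_point_of S} | S. S \<in> C \<and> 3 simplex S}"


section \<open>Dihedral and solid angles\<close>

text \<open>Here \<open>B\<close> is a symmetric bilinear form that is positive definite on the space spanned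
  by the vectors involved: the Euclidean inner product, or the Lorentz form restricted to a tangent
  space of hyperbolic space.\<close>

definition angle_between :: "('a \<Rightarrow> 'a \<Rightarrow> real) \<Rightarrow> 'a \<Rightarrow> 'a \<Rightarrow> real" where
  "angle_between B v w = arccos (B v w / (sqrt (B v v) * sqrt (B w w)))"

definition orth_part :: "('a::real_vector \<Rightarrow> 'a \<Rightarrow> real) \<Rightarrow> 'a \<Rightarrow> 'a \<Rightarrow> 'a" where
  "orth_part B u v = v - (B v u / B u u) *\<^sub>R u"

text \<open>The dihedral angle, along the ray spanned by \<open>u\<close>, between the half-plane
  through \<open>v\<close> and the half-plane through \<open>w\<close>.\<close>

definition dihedral_angle :: "('a::real_vector \<Rightarrow> 'a \<Rightarrow> real) \<Rightarrow> 'a \<Rightarrow> 'a \<Rightarrow> 'a \<Rightarrow> real" where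
  "dihedral_angle B u v w = angle_between B (orth_part B u v) (orth_part B u w)"

text \<open>The solid angle of the cone spanned by three tangent vectors, i.e. the area of a
  spherical triangle as its angle excess.\<close>

definition cone_solid_angle :: "('a::real_vector \<Rightarrow> 'a \<Rightarrow> real) \<Rightarrow> 'a \<Rightarrow> 'a \<Rightarrow> 'a \<Rightarrow> real" where
  "cone_solid_angle B u v w =
     dihedral_angle B u v w + dihedral_angle B v w u + dihedral_angle B w u v - pi"


section \<open>Euclidean tetrahedra\<close>

text \<open>\<open>p\<close> places the four elements of \<open>W\<close> at the vertices of a nondegenerate
  tetrahedron with edge lengths \<open>l\<close>.\<close>

definition euclidean_tetrahedron ::
    "('v \<Rightarrow> 'v \<Rightarrow> real) \<Rightarrow> 'v set \<Rightarrow> ('v \<Rightarrow> real^3) \<Rightarrow> bool" where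
  "euclidean_tetrahedron l W p \<longleftrightarrow>
     inj_on p W \<and> \<not> affine_dependent (p ` W) \<and>
     (\<forall>i\<in>W. \<forall>j\<in>W. i \<noteq> j \<longrightarrow> dist (p i) (p j) = l i j)"

text \<open>The solid angle at \<open>i\<close> does not depend on the placement \<open>p\<close> or on the
  enumeration \<open>j, k, m\<close> of the other vertices; see \<open>euclidean_solid_angle_eq\<close>.\<close>

definition euclidean_solid_angle :: "('v \<Rightarrow> 'v \<Rightarrow> real) \<Rightarrow> 'v set \<Rightarrow> 'v \<Rightarrow> real" where
  "euclidean_solid_angle l W i =
     (THE a. \<exists>p j k m. euclidean_tetrahedron l W p \<and> W = {i, j, k, m} \<and> card W = 4 \<and>
        a = cone_solid_angle (\<bullet>) (p j - p i) (p k - p i) (p m - p i))"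


section \<open>Hyperbolic tetrahedra\<close>

text \<open>Hyperbolic 3-space of curvature \<open>-1\<close> is modelled by the upper sheet of the
  hyperboloid in Minkowski space.\<close>

definition lorentz :: "real \<times> (real^3) \<Rightarrow> real \<times> (real^3) \<Rightarrow> real" where
  "lorentz x y = snd x \<bullet> snd y - fst x * fst y"

definition hyperbolic_space :: "(real \<times> (real^3)) set" where
  "hyperbolic_space = {x. lorentz x x = -1 \<and> fst x > 0}"

definition hyperbolic_dist :: "real \<times> (real^3) \<Rightarrow> real \<times> (real^3) \<Rightarrow> real" where
  "hyperbolic_dist x y = arcosh (- lorentz x y)"

text \<open>Hyperbolic planes are the intersections of hyperbolic space with 3-dimensional linear
  subspaces, so four points lie in no common plane iff they are linearly independent.\<close>

definition hyperbolic_tetrahedron ::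
    "('v \<Rightarrow> 'v \<Rightarrow> real) \<Rightarrow> 'v set \<Rightarrow> ('v \<Rightarrow> real \<times> (real^3)) \<Rightarrow> bool" where
  "hyperbolic_tetrahedron l W p \<longleftrightarrow>
     p ` W \<subseteq> hyperbolic_space \<and> inj_on p W \<and> independent (p ` W) \<and>
     (\<forall>i\<in>W. \<forall>j\<in>W. i \<noteq> j \<longrightarrow> hyperbolic_dist (p i) (p j) = l i j)"

text \<open>The Lorentz-orthogonal projection of \<open>y\<close> to the tangent space at \<open>x\<close>; it is
  a positive multiple of the initial velocity of the geodesic from \<open>x\<close> to \<open>y\<close>.\<close>

definition hyperbolic_direction :: "real \<times> (real^3) \<Rightarrow> real \<times> (real^3) \<Rightarrow> real \<times> (real^3)" where
  "hyperbolic_direction x y = y + lorentz x y *\<^sub>R x"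

definition hyperbolic_solid_angle :: "('v \<Rightarrow> 'v \<Rightarrow> real) \<Rightarrow> 'v set \<Rightarrow> 'v \<Rightarrow> real" where
  "hyperbolic_solid_angle l W i =
     (THE a. \<exists>p j k m. hyperbolic_tetrahedron l W p \<and> W = {i, j, k, m} \<and> card W = 4 \<and>
        a = cone_solid_angle lorentz (hyperbolic_direction (p i) (p j))
              (hyperbolic_direction (p i) (p k)) (hyperbolic_direction (p i) (p m)))"


section \<open>Sphere packing metrics and combinatorial scalar curvature\<close>

definition edge_length :: "('v \<Rightarrow> real) \<Rightarrow> 'v \<Rightarrow> 'v \<Rightarrow> real" where
  "edge_length r i j = r i + r j"

definition euclidean_sphere_packing_metric ::
    "'v::euclidean_space set set \<Rightarrow> ('v \<Rightarrow> real) \<Rightarrow> bool" where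
  "euclidean_sphere_packing_metric C r \<longleftrightarrow>
     (\<forall>i\<in>vertices C. r i > 0) \<and>
     (\<forall>W\<in>tetrahedra C. \<exists>p. euclidean_tetrahedron (edge_length r) W p)"

definition hyperbolic_sphere_packing_metric ::
    "'v::euclidean_space set set \<Rightarrow> ('v \<Rightarrow> real) \<Rightarrow> bool" where
  "hyperbolic_sphere_packing_metric C r \<longleftrightarrow>
     (\<forall>i\<in>vertices C. r i > 0) \<and>
     (\<forall>W\<in>tetrahedra C. \<exists>p. hyperbolic_tetrahedron (edge_length r) W p)"

definition euclidean_curvature ::
    "'v::euclidean_space set set \<Rightarrow> ('v \<Rightarrow> real) \<Rightarrow> 'v \<Rightarrow> real" where
  "euclidean_curvature C r i =
     4 * pi - (\<Sum>W | W \<in> tetrahedra C \<and> i \<in> W. euclidean_solid_angle (edge_length r) W i)"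

definition hyperbolic_curvature ::
    "'v::euclidean_space set set \<Rightarrow> ('v \<Rightarrow> real) \<Rightarrow> 'v \<Rightarrow> real" where
  "hyperbolic_curvature C r i =
     4 * pi - (\<Sum>W | W \<in> tetrahedra C \<and> i \<in> W. hyperbolic_solid_angle (edge_length r) W i)"


section \<open>The solid angles are well defined\<close>

lemma inner_orth_part:
  assumes "bilinear B" and sym: "\<And>x y. B x y = B y x"
  shows "B (orth_part B u v) (orth_part B u w) = B v w - B v u * B w u / B u u"
proof (cases "B u u = 0")
  case True
  then show ?thesis by (simp add: orth_part_def)
next
  case False
  have "B (orth_part B u v) (orth_part B u w) =
      B v w - B w u / B u u * B v u - (B v u / B u u * B w u - B v u / B u u * (B w u / B u u * B u u))"
    using assms(1) unfolding orth_part_def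
    by (simp only: bilinear_lsub bilinear_rsub bilinear_lmul bilinear_rmul sym[of u w]
        real_scaleR_def right_diff_distrib)
  also have "\<dots> = B v w - B v u * B w u / B u u"
    using False by simp
  finally show ?thesis .
qed

lemma dihedral_angle_cong:
  assumes "bilinear B" and "\<And>x y. B x y = B y x"
    and "B u u = B u' u'" "B v v = B v' v'" "B w w = B w' w'"
    and "B u v = B u' v'" "B u w = B u' w'" "B v w = B v' w'"
  shows "dihedral_angle B u v w = dihedral_angle B u' v' w'"
  unfolding dihedral_angle_def angle_between_def inner_orth_part[OF assms(1,2)]
  by (simp only: assms(3-) assms(2)[of v u] assms(2)[of w u] assms(2)[of v' u'] assms(2)[of w' u'])

lemma cone_solid_angle_cong:
  assumes "bilinear B" and sym: "\<And>x y. B x y = B y x"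
    and "B u u = B u' u'" "B v v = B v' v'" "B w w = B w' w'"
    and "B u v = B u' v'" "B u w = B u' w'" "B v w = B v' w'"
  shows "cone_solid_angle B u v w = cone_solid_angle B u' v' w'"
proof -
  have "dihedral_angle B u v w = dihedral_angle B u' v' w'"
    "dihedral_angle B v w u = dihedral_angle B v' w' u'"
    "dihedral_angle B w u v = dihedral_angle B w' u' v'"
    by (rule dihedral_angle_cong[OF assms(1) sym];
        simp only: assms(3-) sym[of v u] sym[of v' u'] sym[of w v] sym[of w' v'] sym[of w u] sym[of w' u'])+
  then show ?thesis by (simp add: cone_solid_angle_def)
qed

lemma dihedral_angle_swap:
  assumes "\<And>x y. B x y = B y x"
  shows "dihedral_angle B u v w = dihedral_angle B u w v"
  unfolding dihedral_angle_def angle_between_def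
  by (subst assms) (simp add: mult.commute)

lemma cone_solid_angle_swap:
  assumes "\<And>x y. B x y = B y x"
  shows "cone_solid_angle B u v w = cone_solid_angle B v u w"
    and "cone_solid_angle B u v w = cone_solid_angle B u w v"
  using dihedral_angle_swap[of B u v w, OF assms] dihedral_angle_swap[of B v w u, OF assms]
    dihedral_angle_swap[of B w u v, OF assms]
  unfolding cone_solid_angle_def by linarith+

lemma cone_solid_angle_enum:
  assumes sym: "\<And>x y. B x y = B y x"
    and "{i, j, k, m} = {i, j', k', m'}" "card {i, j, k, m} = 4"
  shows "cone_solid_angle B (f j) (f k) (f m) = cone_solid_angle B (f j') (f k') (f m')"
proof -
  have d: "distinct [i, j, k, m]" "distinct [i, j', k', m']"
    using assms(2,3) by (intro card_distinct; simp)+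
  then have eq: "{j, k, m} = {j', k', m'}"
    using assms(2) by auto
  note s = cone_solid_angle_swap[of B, OF sym]
  have "(j, k, m) \<in> {(j', k', m'), (j', m', k'), (k', j', m'), (k', m', j'), (m', j', k'), (m', k', j')}"
  proof -
    have "j = j' \<and> {k, m} = {k', m'} \<or> j = k' \<and> {k, m} = {j', m'} \<or> j = m' \<and> {k, m} = {j', k'}"
    proof -
      have "{k, m} = {j', k', m'} - {j}" using d eq by auto
      moreover have "j = j' \<or> j = k' \<or> j = m'" using eq by auto
      ultimately show ?thesis using d(2) by auto
    qed
    then show ?thesis by (auto simp: doubleton_eq_iff)
  qed
  then have cases: "j = j' \<and> k = k' \<and> m = m' \<or> j = j' \<and> k = m' \<and> m = k' \<or>
      j = k' \<and> k = j' \<and> m = m' \<or> j = k' \<and> k = m' \<and> m = j' \<or>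
      j = m' \<and> k = j' \<and> m = k' \<or> j = m' \<and> k = k' \<and> m = j'"
    by simp
  have xzy: "cone_solid_angle B x z y = cone_solid_angle B x y z" for x y z
    by (rule s(2))
  have yxz: "cone_solid_angle B y x z = cone_solid_angle B x y z" for x y z
    by (rule s(1))
  have yzx: "cone_solid_angle B y z x = cone_solid_angle B x y z" for x y z
    by (rule trans[OF xzy yxz])
  have zxy: "cone_solid_angle B z x y = cone_solid_angle B x y z" for x y z
    by (rule trans[OF yxz xzy])
  have zyx: "cone_solid_angle B z y x = cone_solid_angle B x y z" for x y z
    by (rule trans[OF xzy zxy])
  from cases show ?thesis
    by (elim disjE conjE) (hypsubst, rule refl xzy yxz yzx zxy zyx)+
qed

lemma euclidean_solid_angle_eq:
  assumes p: "euclidean_tetrahedron l W p" and W: "W = {i, j, k, m}" "card W = 4"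
  shows "euclidean_solid_angle l W i =
           cone_solid_angle (\<bullet>) (p j - p i) (p k - p i) (p m - p i)"
  unfolding euclidean_solid_angle_def
proof (rule the_equality)
  fix a
  assume "\<exists>p j k m. euclidean_tetrahedron l W p \<and> W = {i, j, k, m} \<and> card W = 4 \<and>
        a = cone_solid_angle (\<bullet>) (p j - p i) (p k - p i) (p m - p i)"
  then obtain q j' k' m' where q: "euclidean_tetrahedron l W q" "W = {i, j', k', m'}"
    and a: "a = cone_solid_angle (\<bullet>) (q j' - q i) (q k' - q i) (q m' - q i)" by blast
  have dist: "dist (p x) (p y) = dist (q x) (q y)" if "x \<in> W" "y \<in> W" for x y
    using p q(1) that unfolding euclidean_tetrahedron_def by (cases "x = y") auto
  have polar: "(f x - f i) \<bullet> (f y - f i) =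
      ((dist (f x) (f i))\<^sup>2 + (dist (f y) (f i))\<^sup>2 - (dist (f x) (f y))\<^sup>2) / 2"
    for f :: "'a \<Rightarrow> real^3" and x y
    by (simp add: dist_norm power2_norm_eq_inner inner_diff_left inner_diff_right inner_commute)
  have gram: "(p x - p i) \<bullet> (p y - p i) = (q x - q i) \<bullet> (q y - q i)" if "x \<in> W" "y \<in> W" for x y
    unfolding polar using that W(1) by (simp add: dist)
  have enum: "{i, j', k', m'} = {i, j, k, m}" "card {i, j', k', m'} = 4"
    by (rule trans[OF q(2)[symmetric] W(1)], rule trans[OF arg_cong[of _ _ card, OF q(2)[symmetric]] W(2)])
  have "a = cone_solid_angle (\<bullet>) (q j - q i) (q k - q i) (q m - q i)"
    unfolding a by (rule cone_solid_angle_enum[where f = "\<lambda>x. q x - q i", OF inner_commute enum(1,2)])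
  also have "\<dots> = cone_solid_angle (\<bullet>) (p j - p i) (p k - p i) (p m - p i)"
    using bounded_bilinear_inner
    by (intro cone_solid_angle_cong[OF _ inner_commute] gram[symmetric])
      (simp_all add: W(1) bilinear_conv_bounded_bilinear)
  finally show "a = cone_solid_angle (\<bullet>) (p j - p i) (p k - p i) (p m - p i)" .
qed (rule exI[of _ p], rule exI[of _ j], rule exI[of _ k], rule exI[of _ m], intro conjI p W refl)

lemma bilinear_lorentz: "bilinear lorentz"
  unfolding bilinear_def lorentz_def
  by (intro conjI allI linearI)
    (simp_all only: fst_add snd_add fst_scaleR snd_scaleR inner_add_left inner_add_right
      inner_scaleR_left inner_scaleR_right real_scaleR_def distrib_left distrib_right
      right_diff_distrib mult.assoc mult.left_commute)

lemma lorentz_commute: "lorentz x y = lorentz y x"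
  by (simp add: lorentz_def inner_commute mult.commute)

lemma lorentz_le:
  assumes "x \<in> hyperbolic_space" "y \<in> hyperbolic_space"
  shows "- lorentz x y \<ge> 1"
proof -
  obtain s a t b where xy: "x = (s, a)" "y = (t, b)" by force
  have s: "s > 0" "s\<^sup>2 = 1 + (norm a)\<^sup>2" and t: "t > 0" "t\<^sup>2 = 1 + (norm b)\<^sup>2"
    using assms by (auto simp: hyperbolic_space_def lorentz_def xy power2_norm_eq_inner power2_eq_square[of s]
        power2_eq_square[of t])
  have "(1 + norm a * norm b)\<^sup>2 \<le> (s * t)\<^sup>2"
    using sum_squares_bound[of "norm a" "norm b"]
    unfolding power_mult_distrib s(2) t(2) by (simp add: algebra_simps power2_eq_square)
  then have "1 + norm a * norm b \<le> s * t"
    by (rule power2_le_imp_le) (use s(1) t(1) in simp)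
  moreover have "a \<bullet> b \<le> norm a * norm b" by (rule norm_cauchy_schwarz)
  ultimately show ?thesis by (simp add: lorentz_def xy)
qed

lemma hyperbolic_dist_cong:
  assumes "x \<in> hyperbolic_space" "y \<in> hyperbolic_space" "x' \<in> hyperbolic_space" "y' \<in> hyperbolic_space"
    and "hyperbolic_dist x y = hyperbolic_dist x' y'"
  shows "lorentz x y = lorentz x' y'"
proof -
  have "- lorentz x y = cosh (arcosh (- lorentz x y))"
    by (rule cosh_arcosh_real[symmetric, OF lorentz_le[OF assms(1,2)]])
  also have "\<dots> = cosh (arcosh (- lorentz x' y'))"
    by (rule arg_cong[where f = cosh, OF assms(5)[unfolded hyperbolic_dist_def]])
  also have "\<dots> = - lorentz x' y'"
    by (rule cosh_arcosh_real[OF lorentz_le[OF assms(3,4)]])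
  finally show ?thesis by (simp only: neg_equal_iff_equal)
qed

lemma hyperbolic_solid_angle_eq:
  assumes p: "hyperbolic_tetrahedron l W p" and W: "W = {i, j, k, m}" "card W = 4"
  shows "hyperbolic_solid_angle l W i =
           cone_solid_angle lorentz (hyperbolic_direction (p i) (p j))
             (hyperbolic_direction (p i) (p k)) (hyperbolic_direction (p i) (p m))"
  unfolding hyperbolic_solid_angle_def
proof (rule the_equality)
  fix a
  assume "\<exists>p j k m. hyperbolic_tetrahedron l W p \<and> W = {i, j, k, m} \<and> card W = 4 \<and>
        a = cone_solid_angle lorentz (hyperbolic_direction (p i) (p j))
              (hyperbolic_direction (p i) (p k)) (hyperbolic_direction (p i) (p m))"
  then obtain q j' k' m' where q: "hyperbolic_tetrahedron l W q" "W = {i, j', k', m'}"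
    and a: "a = cone_solid_angle lorentz (hyperbolic_direction (q i) (q j'))
              (hyperbolic_direction (q i) (q k')) (hyperbolic_direction (q i) (q m'))" by blast
  have B: "lorentz (p x) (p y) = lorentz (q x) (q y)" if "x \<in> W" "y \<in> W" for x y
  proof (cases "x = y")
    case True
    then show ?thesis
      using p q(1) that unfolding hyperbolic_tetrahedron_def hyperbolic_space_def image_subset_iff
      by simp
  next
    case False
    then show ?thesis
      using p q(1) that unfolding hyperbolic_tetrahedron_def
      by (intro hyperbolic_dist_cong) auto
  qed
  have expand: "lorentz (hyperbolic_direction o' x) (hyperbolic_direction o' y) =
      lorentz x y + lorentz o' y * lorentz x o' + lorentz o' x * lorentz o' y
      + lorentz o' x * lorentz o' y * lorentz o' o'" for o' x y
    unfolding hyperbolic_direction_def using bilinear_lorentz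
    by (simp add: bilinear_ladd bilinear_radd bilinear_lmul bilinear_rmul algebra_simps)
  have gram: "lorentz (hyperbolic_direction (p i) (p x)) (hyperbolic_direction (p i) (p y)) =
     lorentz (hyperbolic_direction (q i) (q x)) (hyperbolic_direction (q i) (q y))"
    if "x \<in> W" "y \<in> W" for x y
    unfolding expand using that W(1) by (simp add: B)
  have enum: "{i, j', k', m'} = {i, j, k, m}" "card {i, j', k', m'} = 4"
    by (rule trans[OF q(2)[symmetric] W(1)], rule trans[OF arg_cong[of _ _ card, OF q(2)[symmetric]] W(2)])
  have "a = cone_solid_angle lorentz (hyperbolic_direction (q i) (q j))
              (hyperbolic_direction (q i) (q k)) (hyperbolic_direction (q i) (q m))"
    unfolding a
    by (rule cone_solid_angle_enum[where f = "\<lambda>x. hyperbolic_direction (q i) (q x)",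
          OF lorentz_commute enum(1,2)])
  also have "\<dots> = cone_solid_angle lorentz (hyperbolic_direction (p i) (p j))
              (hyperbolic_direction (p i) (p k)) (hyperbolic_direction (p i) (p m))"
    by (intro cone_solid_angle_cong[OF bilinear_lorentz lorentz_commute] gram[symmetric])
      (simp_all add: W(1))
  finally show "a = cone_solid_angle lorentz (hyperbolic_direction (p i) (p j))
              (hyperbolic_direction (p i) (p k)) (hyperbolic_direction (p i) (p m))" .
qed (rule exI[of _ p], rule exI[of _ j], rule exI[of _ k], rule exI[of _ m], intro conjI p W refl)

end

theory Submission
  imports Defs
begin

text \<open>For four mutually tangent spheres there is an angle \<open>\<phi> l\<close> for each face \<open>l\<close> of the tetrahedron of
  centres such that the dihedral angle at an edge is \<open>pi\<close> minus the sum of the angles of the two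
  adjacent faces. Hence the solid angle at vertex \<open>i\<close> is \<open>2 * pi - 2 * (\<Sum>l | l \<noteq> i. \<phi> l)\<close>, and a
  change of radii from \<open>r\<close> to \<open>r'\<close> satisfies \<open>(\<Sum>i. \<Delta>\<alpha> i * \<Delta>r i) = - 2 * (\<Sum>l. \<Delta>\<phi> l * \<Delta>y l)\<close> with \<open>y l\<close>
  the semiperimeter of face \<open>l\<close>. Along the segment from \<open>r\<close> to \<open>r'\<close> the function
  \<open>t \<mapsto> \<Sum>l. \<phi> l * \<Delta>y l\<close> has nonnegative derivative wherever the tetrahedron is nondegenerate (its Jacobian
  is symmetric, nondegenerate up to scaling, and positive for equal radii), while on degenerate radii
  it takes only finitely many values because each \<open>\<phi> l\<close> is \<open>0\<close> or \<open>pi\<close>; so it is monotone. Summed over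
  all tetrahedra, equal curvatures make all these nonpositive terms vanish, so \<open>r\<close> and \<open>r'\<close> are
  proportional (respectively equal) on each tetrahedron. Invariance of dimension shows that every
  simplex lies in a tetrahedron, and connectedness makes the factor global.\<close>

section \<open>Curvatures of four mutually tangent spheres\<close>

text \<open>Curvatures of four mutually tangent spheres of radii \<open>r i\<close> are encoded as \<open>k i = 1 / r i\<close> with
  \<open>e = 0\<close> (Euclidean) or \<open>k i = coth (r i)\<close> with \<open>e = 1\<close> (hyperbolic); in both cases
  \<open>dk/dr = - (k\<^sup>2 - e)\<close>. The tetrahedron of centres is nondegenerate iff the quadratic form
  \<open>descartes\<close> of the Descartes circle theorem is positive. Faces are indexed by the opposite
  vertex: \<open>face_curv e k l\<close> is the sum of the pairwise products of the other three curvatures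
  plus \<open>e\<close>, i.e. the squared curvature of the incircle of face \<open>l\<close>.\<close>

definition slack :: "(4 \<Rightarrow> real) \<Rightarrow> 4 \<Rightarrow> real" where
  "slack k l = sum k UNIV - 2 * k l"

definition descartes :: "real \<Rightarrow> (4 \<Rightarrow> real) \<Rightarrow> real" where
  "descartes e k = (sum k UNIV)\<^sup>2 - 2 * (\<Sum>i\<in>UNIV. (k i)\<^sup>2) + 4 * e"

definition face_curv :: "real \<Rightarrow> (4 \<Rightarrow> real) \<Rightarrow> 4 \<Rightarrow> real" where
  "face_curv e k l = (descartes e k + (slack k l)\<^sup>2) / 4"

lemma face_curv_explicit:
  "face_curv e k 1 = k 2 * k 3 + k 2 * k 4 + k 3 * k 4 + e"
  "face_curv e k 2 = k 1 * k 3 + k 1 * k 4 + k 3 * k 4 + e"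
  "face_curv e k 3 = k 1 * k 2 + k 1 * k 4 + k 2 * k 4 + e"
  "face_curv e k 4 = k 1 * k 2 + k 1 * k 3 + k 2 * k 3 + e"
  by (simp_all add: face_curv_def descartes_def slack_def sum_4 power2_eq_square algebra_simps)

lemma face_curv_pos:
  assumes "0 \<le> e" "\<And>i. 0 < k i"
  shows "0 < face_curv e k l"
proof -
  have "0 < k i * k j" for i j using assms(2) by simp
  then have "0 < k a * k b + k c * k d + k f * k g + e" for a b c d f g
    using assms(1) by (meson add_pos_nonneg add_pos_pos)
  then show ?thesis using exhaust_4[of l] by (auto simp: face_curv_explicit)
qed

text \<open>When \<open>k\<close> varies at rate \<open>- w\<close>, the derivative of \<open>face_angle e k l\<close> (below) is
  \<open>angle_form e k w l / (4 * sqrt (descartes e k) * face_curv e k l)\<close>; since radii changing at rate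
  \<open>x\<close> give \<open>w i = ((k i)\<^sup>2 - e) * x i\<close>, up to the first factor \<open>hess\<close> pairs the resulting change
  of the face angles with the change of the semiperimeters of the faces due to \<open>y\<close>.\<close>

definition angle_form :: "real \<Rightarrow> (4 \<Rightarrow> real) \<Rightarrow> (4 \<Rightarrow> real) \<Rightarrow> 4 \<Rightarrow> real" where
  "angle_form e k w l =
     descartes e k * (sum w UNIV - 2 * w l) - slack k l * (\<Sum>i\<in>UNIV. slack k i * w i)"

definition hess :: "real \<Rightarrow> (4 \<Rightarrow> real) \<Rightarrow> (4 \<Rightarrow> real) \<Rightarrow> (4 \<Rightarrow> real) \<Rightarrow> real" where
  "hess e k x y =
     (\<Sum>l\<in>UNIV. angle_form e k (\<lambda>i. ((k i)\<^sup>2 - e) * x i) l / face_curv e k l * (sum y UNIV - y l))"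

text \<open>The factor \<open>P l\<close> multiplies the symmetric form
  \<open>(sum x UNIV - x l) * (sum y UNIV - y l)\<close>, which is what makes \<open>hess\<close> symmetric.\<close>

lemma angle_form_key:
  "\<exists>P. \<forall>l x. slack k l * ((\<Sum>i\<in>UNIV. ((k i)\<^sup>2 - e) * x i) - 2 * (((k l)\<^sup>2 - e) * x l))
      + (\<Sum>i\<in>UNIV. slack k i * (((k i)\<^sup>2 - e) * x i))
     = P l * (sum x UNIV - x l)
       - face_curv e k l * (slack k l * (sum x UNIV - 2 * x l) + (\<Sum>i\<in>UNIV. slack k i * x i))"
proof (rule choice, rule allI)
  fix l :: 4
  consider "l = 1" | "l = 2" | "l = 3" | "l = 4" using exhaust_4[of l] by blast
  then show "\<exists>P. \<forall>x. slack k l * ((\<Sum>i\<in>UNIV. ((k i)\<^sup>2 - e) * x i) - 2 * (((k l)\<^sup>2 - e) * x l))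
      + (\<Sum>i\<in>UNIV. slack k i * (((k i)\<^sup>2 - e) * x i))
     = P * (sum x UNIV - x l)
       - face_curv e k l * (slack k l * (sum x UNIV - 2 * x l) + (\<Sum>i\<in>UNIV. slack k i * x i))"
  proof cases
    \<comment> \<open>The witness is twice the product of the pairwise sums of the three curvatures
      of the face. It is forced by comparing the coefficients of \<open>x i\<close> for a vertex
      \<open>i\<close> of the face.\<close>
    case 1 show ?thesis unfolding 1
      by (rule exI[of _ "2 * ((k 2 + k 3) * (k 2 + k 4) * (k 3 + k 4))"], rule allI,
          simp add: face_curv_explicit slack_def sum_4 algebra_simps power2_eq_square)
  next
    case 2 show ?thesis unfolding 2
      by (rule exI[of _ "2 * ((k 1 + k 3) * (k 1 + k 4) * (k 3 + k 4))"], rule allI,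
          simp add: face_curv_explicit slack_def sum_4 algebra_simps power2_eq_square)
  next
    case 3 show ?thesis unfolding 3
      by (rule exI[of _ "2 * ((k 1 + k 2) * (k 1 + k 4) * (k 2 + k 4))"], rule allI,
          simp add: face_curv_explicit slack_def sum_4 algebra_simps power2_eq_square)
  next
    case 4 show ?thesis unfolding 4
      by (rule exI[of _ "2 * ((k 1 + k 2) * (k 1 + k 3) * (k 2 + k 3))"], rule allI,
          simp add: face_curv_explicit slack_def sum_4 algebra_simps power2_eq_square)
  qed
qed

text \<open>The sum is the part of \<open>hess\<close> free of division by \<open>face_curv\<close>
  (see \<open>hess_commute\<close>); the expanded form is visibly symmetric in \<open>x\<close> and
  \<open>y\<close>.\<close>

lemma hess_poly_eq:
  fixes k x y :: "4 \<Rightarrow> real"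
  defines "m \<equiv> slack k" and "S \<equiv> sum k UNIV" and "X \<equiv> sum x UNIV" and "Y \<equiv> sum y UNIV"
  shows "(\<Sum>l\<in>UNIV. (4 * ((\<Sum>i\<in>UNIV. ((k i)\<^sup>2 - e) * x i) - 2 * (((k l)\<^sup>2 - e) * x l))
       + m l * (m l * (X - 2 * x l) + (\<Sum>i\<in>UNIV. m i * x i))) * (Y - y l))
   = X * Y * (S\<^sup>2 - 4 * e + (\<Sum>i\<in>UNIV. (m i)\<^sup>2)) - Y * (\<Sum>i\<in>UNIV. (m i)\<^sup>2 * x i) - X * (\<Sum>i\<in>UNIV. (m i)\<^sup>2 * y i)
     + (\<Sum>i\<in>UNIV. (8 * ((k i)\<^sup>2 - e) + 2 * (m i)\<^sup>2) * x i * y i)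
     - (\<Sum>i\<in>UNIV. m i * x i) * (\<Sum>i\<in>UNIV. m i * y i)"
proof -
  define L where "L = (\<Sum>i\<in>UNIV. m i * x i)"
  define W where "W = (\<Sum>i\<in>UNIV. ((k i)\<^sup>2 - e) * x i)"
  have k: "k i = (S - m i) / 2" for i by (simp add: m_def slack_def S_def)
  have M: "sum m UNIV = 2 * S" by (simp add: m_def slack_def S_def sum_subtractf sum_distrib_left[symmetric])
  \<comment> \<open>Writing \<open>k\<close> through the slacks produces the symmetry: the
    \<open>S * L\<close> terms cancel, and one of the two copies of \<open>Y\<close> times the sum
    of \<open>(m i)\<^sup>2 * x i\<close> disappears.\<close>
  have W: "4 * W = (\<Sum>i\<in>UNIV. (m i)\<^sup>2 * x i) - 2 * S * L + (S\<^sup>2 - 4 * e) * X"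
  proof -
    have "4 * W = (\<Sum>i\<in>UNIV. (m i)\<^sup>2 * x i - 2 * S * (m i * x i) + (S\<^sup>2 - 4 * e) * x i)"
      unfolding W_def sum_distrib_left by (rule sum.cong) (simp_all add: k field_simps power2_eq_square)
    then show ?thesis unfolding L_def X_def by (simp add: sum.distrib sum_subtractf sum_distrib_left)
  qed
  have "(\<Sum>l\<in>UNIV. (4 * (W - 2 * (((k l)\<^sup>2 - e) * x l)) + m l * (m l * (X - 2 * x l) + L)) * (Y - y l))
     = (\<Sum>l\<in>UNIV. 4 * W * Y - (4 * W) * y l - (8 * Y) * (((k l)\<^sup>2 - e) * x l) + X * Y * (m l)\<^sup>2
         - (2 * Y) * ((m l)\<^sup>2 * x l) + L * Y * m l - X * ((m l)\<^sup>2 * y l) - L * (m l * y l)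
         + (8 * ((k l)\<^sup>2 - e) + 2 * (m l)\<^sup>2) * x l * y l)"
    by (rule sum.cong) (simp_all add: algebra_simps power2_eq_square)
  also have "\<dots> = 4 * (4 * W * Y) - (4 * W) * Y - (8 * Y) * W + X * Y * (\<Sum>i\<in>UNIV. (m i)\<^sup>2)
         - (2 * Y) * (\<Sum>i\<in>UNIV. (m i)\<^sup>2 * x i) + L * Y * (2 * S) - X * (\<Sum>i\<in>UNIV. (m i)\<^sup>2 * y i)
         - L * (\<Sum>i\<in>UNIV. m i * y i)
         + (\<Sum>i\<in>UNIV. (8 * ((k i)\<^sup>2 - e) + 2 * (m i)\<^sup>2) * x i * y i)"
    unfolding sum.distrib sum_subtractf sum_distrib_left[symmetric] M
    by (simp add: W_def Y_def)
  also have "4 * (4 * W * Y) - (4 * W) * Y - (8 * Y) * W = Y * (4 * W)" by simp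
  finally show ?thesis unfolding W W_def[symmetric] L_def[symmetric]
    by (simp add: algebra_simps)
qed

lemma hess_commute:
  assumes "\<And>l. face_curv e k l \<noteq> 0"
  shows "hess e k x y = hess e k y x"
proof -
  obtain P where P: "\<And>l x. slack k l * ((\<Sum>i\<in>UNIV. ((k i)\<^sup>2 - e) * x i) - 2 * (((k l)\<^sup>2 - e) * x l))
      + (\<Sum>i\<in>UNIV. slack k i * (((k i)\<^sup>2 - e) * x i))
     = P l * (sum x UNIV - x l)
       - face_curv e k l * (slack k l * (sum x UNIV - 2 * x l) + (\<Sum>i\<in>UNIV. slack k i * x i))"
    using angle_form_key[of k e] by blast
  \<comment> \<open>Replacing \<open>descartes\<close> by four times \<open>face_curv\<close> minus
    the squared slack and applying the key identity confines the denominator to a multiple of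
    \<open>sum x UNIV - x l\<close>, which pairs symmetrically with
    \<open>sum y UNIV - y l\<close>.\<close>
  have *: "angle_form e k (\<lambda>i. ((k i)\<^sup>2 - e) * x i) l / face_curv e k l =
     4 * ((\<Sum>i\<in>UNIV. ((k i)\<^sup>2 - e) * x i) - 2 * (((k l)\<^sup>2 - e) * x l))
       + slack k l * (slack k l * (sum x UNIV - 2 * x l) + (\<Sum>i\<in>UNIV. slack k i * x i))
       - slack k l * P l / face_curv e k l * (sum x UNIV - x l)" for x l
  proof -
    have Q: "descartes e k = 4 * face_curv e k l - (slack k l)\<^sup>2"
      by (simp add: face_curv_def field_simps)
    have "angle_form e k (\<lambda>i. ((k i)\<^sup>2 - e) * x i) l =
        4 * face_curv e k l * ((\<Sum>i\<in>UNIV. ((k i)\<^sup>2 - e) * x i) - 2 * (((k l)\<^sup>2 - e) * x l))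
        - slack k l * (slack k l * ((\<Sum>i\<in>UNIV. ((k i)\<^sup>2 - e) * x i) - 2 * (((k l)\<^sup>2 - e) * x l))
      + (\<Sum>i\<in>UNIV. slack k i * (((k i)\<^sup>2 - e) * x i)))"
      unfolding angle_form_def Q by (simp add: algebra_simps power2_eq_square)
    then show ?thesis unfolding P using assms[of l] by (simp add: field_simps)
  qed
  show ?thesis
    unfolding hess_def * left_diff_distrib[of _ _ "_ - _"] sum_subtractf hess_poly_eq
    by (simp add: mult_ac)
qed


section \<open>Kernel of the angle form\<close>

lemma sum_slack: "sum (slack k) UNIV = 2 * sum k UNIV"
  by (simp add: slack_def sum_subtractf sum_distrib_left[symmetric])

text \<open>Euler's relation: \<open>slack\<close> is half the gradient of \<open>descartes\<close>,
  which is homogeneous quadratic in \<open>k\<close> up to the term \<open>4 * e\<close>.\<close>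

lemma sum_slack_mult: "(\<Sum>i\<in>UNIV. slack k i * k i) = descartes e k - 4 * e"
proof -
  have "(\<Sum>i\<in>UNIV. slack k i * k i) = (\<Sum>i\<in>UNIV. sum k UNIV * k i - 2 * (k i)\<^sup>2)"
    by (rule sum.cong) (simp_all add: slack_def algebra_simps power2_eq_square)
  then show ?thesis
    by (simp add: descartes_def sum_subtractf sum_distrib_left[symmetric] power2_eq_square)
qed

text \<open>Summing the equations over \<open>l\<close> determines \<open>sum w UNIV\<close>, which
  makes \<open>w\<close> a multiple of \<open>k\<close>; feeding this back into the slack-weighted
  sum of \<open>w\<close> shows that the multiplier is annihilated by \<open>e\<close>. So the
  kernel is infinitesimal scaling for \<open>e = 0\<close> and trivial otherwise.\<close>

lemma angle_form_eq_0:
  assumes Q: "descartes e k \<noteq> 0" and z: "\<And>l. angle_form e k w l = 0"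
  obtains c where "\<And>l. w l = c * k l" "e * c = 0"
proof -
  define R where "R = (\<Sum>i\<in>UNIV. slack k i * w i)"
  define W where "W = sum w UNIV"
  define D where "D = descartes e k"
  have 1: "D * (W - 2 * w l) = slack k l * R" for l
    using z[of l] by (simp add: angle_form_def R_def W_def D_def)
  have "(\<Sum>l\<in>UNIV. D * (W - 2 * w l)) = (\<Sum>l\<in>UNIV. slack k l * R)" by (simp add: 1)
  then have "2 * (D * W) = 2 * (sum k UNIV * R)"
    by (simp add: sum_distrib_left[symmetric] sum_distrib_right[symmetric] sum_subtractf sum_slack W_def[symmetric])
  then have 2: "D * W = sum k UNIV * R" by simp
  have 3: "D * w l = R * k l" for l
    using 1[of l] 2 by (simp add: slack_def algebra_simps)
  have "D * R = (\<Sum>l\<in>UNIV. slack k l * (D * w l))"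
    by (simp add: R_def sum_distrib_left mult_ac)
  also have "\<dots> = R * (\<Sum>l\<in>UNIV. slack k l * k l)"
    unfolding 3 by (simp add: sum_distrib_left mult_ac)
  also have "\<dots> = R * (D - 4 * e)" unfolding sum_slack_mult[of k e] D_def ..
  finally have "e * R = 0" by (simp add: algebra_simps)
  moreover have "w l = (R / D) * k l" for l using 3[of l] Q by (simp add: D_def field_simps)
  ultimately show ?thesis using that[of "R / D"] by simp
qed

section \<open>Bilinearity and radical of \<open>hess\<close>\<close>

lemma angle_form_linear:
  "angle_form e k (\<lambda>i. x i + s * y i) l = angle_form e k x l + s * angle_form e k y l"
  by (simp add: angle_form_def sum.distrib sum_distrib_left[symmetric] algebra_simps)

lemma hess_linear_left:
  "hess e k (\<lambda>i. x i + s * y i) z = hess e k x z + s * hess e k y z"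
proof -
  have "(\<lambda>i. ((k i)\<^sup>2 - e) * (x i + s * y i)) = (\<lambda>i. ((k i)\<^sup>2 - e) * x i + s * (((k i)\<^sup>2 - e) * y i))"
    by (simp add: algebra_simps)
  then show ?thesis
    by (simp add: hess_def angle_form_linear add_divide_distrib distrib_right sum.distrib sum_distrib_left mult.assoc)
qed

lemma hess_linear_right:
  "hess e k z (\<lambda>i. x i + s * y i) = hess e k z x + s * hess e k z y"
proof -
  have "sum (\<lambda>i. x i + s * y i) UNIV - (x l + s * y l) = (sum x UNIV - x l) + s * (sum y UNIV - y l)" for l
    by (simp add: sum.distrib sum_distrib_left[symmetric] algebra_simps)
  note * = this
  show ?thesis
    unfolding hess_def * by (simp add: distrib_left add_divide_distrib sum.distrib sum_distrib_left mult.left_commute)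
qed

lemma hess_scale: "hess e k (\<lambda>i. s * x i) (\<lambda>i. s * x i) = s\<^sup>2 * hess e k x x"
  using hess_linear_left[of e k "\<lambda>_. 0" s x] hess_linear_right[of e k _ "\<lambda>_. 0" s x]
  by (simp add: hess_def[of e k "\<lambda>_. 0"] hess_def[of e k _ "\<lambda>_. 0"] angle_form_def[of e k "\<lambda>_. 0"] power2_eq_square)

text \<open>A null vector of a positive semidefinite symmetric form lies in its radical. Pairing
  with the unit vectors then gives the claim, since the matrix with 0 on the diagonal and 1
  elsewhere is invertible.\<close>

lemma hess_zero_imp_angle_form_zero:
  assumes s: "\<And>l. face_curv e k l \<noteq> 0"
    and psd: "\<And>y. 0 \<le> hess e k y y" and x: "hess e k x x \<le> 0"
  shows "angle_form e k (\<lambda>i. ((k i)\<^sup>2 - e) * x i) l = 0"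
proof -
  have "hess e k x y = 0" for y
  proof (rule ccontr)
    assume ne: "hess e k x y \<noteq> 0"
    define b where "b = hess e k x y"
    \<comment> \<open>Adding 1 keeps \<open>c\<close> positive even if \<open>y\<close> is itself
      null; moving by \<open>- b / c\<close> along \<open>y\<close> then makes the form
      negative.\<close>
    define c where "c = hess e k y y + 1"
    have c: "c > 0" "hess e k y y < c" using psd[of y] by (auto simp: c_def)
    have "0 \<le> hess e k (\<lambda>i. x i + (- b / c) * y i) (\<lambda>i. x i + (- b / c) * y i)" by (rule psd)
    also have "\<dots> = hess e k x x + 2 * (- b / c) * b + (b / c)\<^sup>2 * hess e k y y"
      unfolding hess_linear_left hess_linear_right hess_commute[OF s, of y x] b_def
      by (simp add: algebra_simps power2_eq_square)
    also have "\<dots> \<le> 2 * (- b / c) * b + (b / c)\<^sup>2 * c"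
      using x c by (intro add_mono) (auto intro!: mult_left_mono)
    also have "\<dots> = - b\<^sup>2 / c" using c(1) by (simp add: field_simps power2_eq_square)
    also have "\<dots> < 0" using ne c(1) by (simp add: b_def)
    finally show False by simp
  qed
  note z = this
  define g where "g l = angle_form e k (\<lambda>i. ((k i)\<^sup>2 - e) * x i) l / face_curv e k l" for l
  have g: "g j = sum g UNIV" for j
  proof -
    have "0 = hess e k x (\<lambda>i. if i = j then 1 else 0)" by (simp add: z)
    also have "\<dots> = (\<Sum>l\<in>UNIV. g l - (if l = j then g l else 0))"
      unfolding hess_def g_def[symmetric] by (rule sum.cong) auto
    also have "\<dots> = sum g UNIV - g j" by (simp add: sum_subtractf)
    finally show ?thesis by simp
  qed
  \<comment> \<open>All \<open>g j\<close> equal their total, so the total is four times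
    itself.\<close>
  have "sum g UNIV = (\<Sum>j\<in>(UNIV :: 4 set). sum g UNIV)" by (rule sum.cong[OF refl g])
  then have "sum g UNIV = 0" by simp
  then have "g l = 0" using g[of l] by (rule trans[rotated])
  then show ?thesis using s[of l] by (simp add: g_def)
qed

text \<open>With \<open>X\<close> the sum and \<open>N\<close> the sum of squares of
  \<open>x\<close>, the form is a positive multiple of
  \<open>4 * (c\<^sup>2 - e) * (4 * N - X\<^sup>2) + 24 * e * N\<close>. The first term is
  nonnegative by Cauchy-Schwarz, the second positive because \<open>e\<close> is.\<close>

lemma hess_const_pos:
  assumes "0 < e" "e < c\<^sup>2" "0 < c" "x \<noteq> (\<lambda>_. 0)"
  shows "0 < hess e (\<lambda>_. c) x x"
proof -
  define X where "X = sum x UNIV"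
  define N where "N = (\<Sum>i\<in>UNIV. (x i)\<^sup>2)"
  have m: "slack (\<lambda>_. c) l = 2 * c" for l by (simp add: slack_def)
  have Q: "descartes e (\<lambda>_. c) = 8 * c\<^sup>2 + 4 * e" by (simp add: descartes_def power2_eq_square)
  have s: "face_curv e (\<lambda>_. c) l = 3 * c\<^sup>2 + e" for l
    by (simp add: face_curv_def m Q power2_eq_square)
  have N: "N > 0"
  proof -
    obtain i where "x i \<noteq> 0" using assms(4) by auto
    then show ?thesis unfolding N_def by (intro sum_pos2[where i = i]) auto
  qed
  have XN: "X\<^sup>2 \<le> 4 * N"
    using sum_squared_le_sum_of_squares[of x UNIV] by (simp add: X_def N_def)
  have "hess e (\<lambda>_. c) x x = (\<Sum>l\<in>UNIV. (c\<^sup>2 - e) / (3 * c\<^sup>2 + e) *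
      ((8 * c\<^sup>2 + 4 * e) * (X\<^sup>2 - 3 * X * x l + 2 * (x l)\<^sup>2) - 4 * c\<^sup>2 * X * (X - x l)))"
    unfolding hess_def
  proof (rule sum.cong)
    fix l :: 4
    show "angle_form e (\<lambda>_. c) (\<lambda>i. (c\<^sup>2 - e) * x i) l / face_curv e (\<lambda>_. c) l * (sum x UNIV - x l) =
      (c\<^sup>2 - e) / (3 * c\<^sup>2 + e) *
      ((8 * c\<^sup>2 + 4 * e) * (X\<^sup>2 - 3 * X * x l + 2 * (x l)\<^sup>2) - 4 * c\<^sup>2 * X * (X - x l))"
      by (simp add: angle_form_def m Q s X_def[symmetric] sum_distrib_left[symmetric] mult.assoc
          power2_eq_square) (simp add: field_simps)
  qed simp
  also have "\<dots> = (c\<^sup>2 - e) / (3 * c\<^sup>2 + e) * ((8 * c\<^sup>2 + 4 * e) * (X\<^sup>2 + 2 * N) - 12 * c\<^sup>2 * X\<^sup>2)"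
    unfolding sum_distrib_left[symmetric] sum_subtractf sum.distrib X_def[symmetric] N_def[symmetric]
    by (simp add: X_def[symmetric] algebra_simps power2_eq_square)
  also have "\<dots> = (c\<^sup>2 - e) / (3 * c\<^sup>2 + e) * (4 * (c\<^sup>2 - e) * (4 * N - X\<^sup>2) + 24 * e * N)"
    by (simp add: algebra_simps)
  also have "\<dots> > 0"
    using assms XN N by (intro mult_pos_pos divide_pos_pos add_nonneg_pos add_pos_pos mult_nonneg_nonneg) auto
  finally show ?thesis .
qed

lemma continuous_on_hess [continuous_intros]:
  assumes "\<And>i. continuous_on A (\<lambda>t. k t i)" "\<And>i. continuous_on A (\<lambda>t. x t i)" "\<And>i. continuous_on A (\<lambda>t. y t i)"
    "continuous_on A e" "\<And>t l. t \<in> A \<Longrightarrow> face_curv (e t) (k t) l \<noteq> 0"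
  shows "continuous_on A (\<lambda>t. hess (e t) (k t) (x t) (y t))"
  using assms(5) unfolding hess_def angle_form_def face_curv_def descartes_def slack_def
  by (intro continuous_intros assms(1-4)) auto

section \<open>Definiteness of the angle Jacobian\<close>

lemma sqrt_less_imp_less_power2:
  fixes e x :: real
  assumes "0 \<le> e" "sqrt e < x"
  shows "e < x\<^sup>2"
  using power_strict_mono[OF assms(2), of 2] assms(1) by simp

text \<open>Contracting \<open>k\<close> linearly to its mean keeps \<open>descartes\<close> positive, the form stays
  nondegenerate along the way, and at constant curvature it is positive definite.\<close>

lemma hess_pos:
  assumes e: "0 < e" and k: "\<And>i. sqrt e < k i" and Q: "0 < descartes e k" and x: "x \<noteq> (\<lambda>_. 0)"
  shows "0 < hess e k x x"
proof -
  define s where "s = sum k UNIV / 4"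
  define K where "K t i = s + t * (k i - s)" for t i
  have s: "sqrt e < s"
  proof -
    have "(\<Sum>i\<in>(UNIV :: 4 set). sqrt e) < sum k UNIV" by (rule sum_strict_mono) (use k in auto)
    then show ?thesis by (simp add: s_def)
  qed
  have K: "sqrt e < K t i" if "t \<in> {0..1}" for t i
  proof -
    have "K t i = (1 - t) * s + t * k i" by (simp add: K_def algebra_simps)
    moreover have "sqrt e < (1 - t) * s + t * k i"
      using convex_bound_lt[of "- s" "- sqrt e" "- k i" "1 - t" t] s k[of i] that by simp
    ultimately show ?thesis by simp
  qed
  have K0: "0 < K t i" if "t \<in> {0..1}" for t i
    using K[OF that, of i] real_sqrt_gt_zero[OF e] by linarith
  have sumK: "sum (K t) UNIV = sum k UNIV" for t
    by (simp add: K_def s_def sum.distrib sum_distrib_left[symmetric] sum_subtractf)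
  have QK: "0 < descartes e (K t)" if "t \<in> {0..1}" for t
  proof -
    \<comment> \<open>The cross term vanishes because deviations from the mean sum to zero. The
      contraction thus only shrinks the variance, which enters \<open>descartes\<close>
      negatively.\<close>
    have 1: "(\<Sum>i\<in>UNIV. (K t i)\<^sup>2) = 4 * s\<^sup>2 + t\<^sup>2 * (\<Sum>i\<in>UNIV. (k i - s)\<^sup>2)" for t
    proof -
      have "(\<Sum>i\<in>UNIV. (K t i)\<^sup>2) = (\<Sum>i\<in>UNIV. s\<^sup>2 + (2 * s * t) * (k i - s) + t\<^sup>2 * (k i - s)\<^sup>2)"
        by (rule sum.cong) (simp_all add: K_def algebra_simps power2_eq_square)
      also have "\<dots> = 4 * s\<^sup>2 + t\<^sup>2 * (\<Sum>i\<in>UNIV. (k i - s)\<^sup>2)"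
        unfolding sum.distrib sum_distrib_left[symmetric] sum_subtractf by (simp add: s_def)
      finally show ?thesis .
    qed
    have K1: "K 1 = k" by (simp add: K_def fun_eq_iff)
    have "t\<^sup>2 \<le> 1" using that by (simp add: abs_square_le_1)
    then have "t\<^sup>2 * (\<Sum>i\<in>UNIV. (k i - s)\<^sup>2) \<le> 1 * (\<Sum>i\<in>UNIV. (k i - s)\<^sup>2)"
      by (intro mult_right_mono sum_nonneg) auto
    then have "descartes e k \<le> descartes e (K t)"
      using 1[of t] 1[of 1] unfolding descartes_def sumK K1 by simp
    then show ?thesis using Q by simp
  qed
  have fc: "face_curv e (K t) l \<noteq> 0" if "t \<in> {0..1}" for t l
    using face_curv_pos[of e "K t" l] K0[OF that] e by auto
  define F where "F p = hess e (K (fst p)) (($) (snd p)) (($) (snd p))" for p :: "real \<times> (real^4)"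
  \<comment> \<open>Bad pairs of a parameter and a unit direction. Normalising the direction makes
    this set compact, so if nonempty it has a pair with least parameter.\<close>
  define Z where "Z = {p \<in> {0..1} \<times> sphere 0 1. F p \<le> 0}"
  have contF: "continuous_on ({0..1} \<times> UNIV) F"
    unfolding F_def using fc by (intro continuous_on_hess) (auto simp: K_def intro!: continuous_intros)
  have scaleF: "F (t, c *\<^sub>R v) = c\<^sup>2 * F (t, v)" for t c v
  proof -
    have "($) (c *\<^sub>R v) = (\<lambda>i. c * v $ i)" by (simp add: fun_eq_iff)
    then show ?thesis using hess_scale[of e "K t" c "($) v"] by (simp add: F_def)
  qed
  have "Z = {}"
  proof (rule ccontr)
    assume "Z \<noteq> {}"
    have "closed Z"
    proof -
      have "closed (({0..1} \<times> sphere 0 1) \<inter> F -` {..0})"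
        by (rule continuous_closed_preimage[OF continuous_on_subset[OF contF]]) (auto intro: closed_Times)
      moreover have "Z = ({0..1} \<times> sphere 0 1) \<inter> F -` {..0}" by (auto simp: Z_def)
      ultimately show ?thesis by simp
    qed
    moreover have "bounded Z"
      by (rule bounded_subset[of "{0..1} \<times> sphere 0 1"]) (auto simp: Z_def intro: bounded_Times)
    ultimately have "compact Z" by (simp add: compact_eq_bounded_closed)
    then have "\<exists>p\<in>Z. \<forall>q\<in>Z. fst p \<le> fst q"
      using \<open>Z \<noteq> {}\<close> continuous_on_fst[OF continuous_on_id] by (rule continuous_attains_inf)
    then obtain p where p: "p \<in> Z" "\<And>q. q \<in> Z \<Longrightarrow> fst p \<le> fst q" by blast
    obtain t v where tv: "p = (t, v)" by force
    have t: "t \<in> {0..1}" "norm v = 1" "F (t, v) \<le> 0" using p(1) by (auto simp: Z_def tv)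
    have "v \<noteq> 0" using t(2) by auto
    then have vx: "($) v \<noteq> (\<lambda>_. 0)" by (auto simp: vec_eq_iff fun_eq_iff)
    have "t \<noteq> 0"
    proof
      assume "t = 0"
      moreover have "K 0 = (\<lambda>_. s)" by (simp add: K_def fun_eq_iff)
      moreover have "e < s\<^sup>2" using sqrt_less_imp_less_power2[OF less_imp_le[OF e] s] .
      ultimately show False
        using hess_const_pos[of e s "($) v"] vx e s t(3) real_sqrt_gt_zero[OF e]
        by (simp add: F_def)
    qed
    have before: "0 \<le> F (u, w)" if u: "u \<in> {0..<t}" for u w
    proof (cases "w = 0")
      case True
      then show ?thesis using scaleF[of u 0 0] by simp
    next
      case False
      have "(u, w /\<^sub>R norm w) \<notin> Z" using p(2)[of "(u, w /\<^sub>R norm w)"] u by (auto simp: tv)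
      then have "0 < F (u, w /\<^sub>R norm w)" using u t(1) False by (auto simp: Z_def)
      then show ?thesis using scaleF[of u "norm w" "w /\<^sub>R norm w"] False by simp
    qed
    \<comment> \<open>At the first bad parameter the form is still semidefinite, as a limit of
      earlier ones, so \<open>v\<close> lies in its radical; but the radical is trivial for
      \<open>e > 0\<close>.\<close>
    have psd: "0 \<le> F (t, w)" for w
    proof (rule continuous_ge_on_closure[of "{0..<t}" "\<lambda>u. F (u, w)"])
      have "closure {0..<t} \<subseteq> {0..1}" using t(1) \<open>t \<noteq> 0\<close> by simp
      then show "continuous_on (closure {0..<t}) (\<lambda>u. F (u, w))"
        by (intro continuous_on_compose2[OF contF]) (auto intro!: continuous_intros)
      show "t \<in> closure {0..<t}" using t(1) \<open>t \<noteq> 0\<close> by simp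
    qed (rule before)
    have psd': "0 \<le> hess e (K t) y y" for y
    proof -
      have "($) (vec_lambda y) = y" by (simp add: fun_eq_iff)
      then show ?thesis using psd[of "vec_lambda y"] by (simp add: F_def)
    qed
    have "angle_form e (K t) (\<lambda>i. ((K t i)\<^sup>2 - e) * v $ i) l = 0" for l
      using hess_zero_imp_angle_form_zero[OF fc[OF t(1)] psd', of "($) v"] t(3) by (simp add: F_def)
    then obtain c where c: "\<And>l. ((K t l)\<^sup>2 - e) * v $ l = c * K t l" "e * c = 0"
      using angle_form_eq_0[of e "K t" "\<lambda>i. ((K t i)\<^sup>2 - e) * v $ i"] QK[OF t(1)] by auto
    have "v $ l = 0" for l
    proof -
      have "(K t l)\<^sup>2 > e"
        using sqrt_less_imp_less_power2[OF less_imp_le[OF e] K[OF t(1), of l]] .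
      then show ?thesis using c(1)[of l] c(2) e by auto
    qed
    then show False using vx by auto
  qed
  define y where "y = (\<chi> i. x i)"
  have "y \<noteq> 0" using x by (auto simp: y_def vec_eq_iff fun_eq_iff)
  then have "(1, y /\<^sub>R norm y) \<notin> Z \<and> norm (y /\<^sub>R norm y) = 1" using \<open>Z = {}\<close> by simp
  then have "0 < F (1, y /\<^sub>R norm y)" by (auto simp: Z_def)
  then have "0 < F (1, y)" using scaleF[of 1 "norm y" "y /\<^sub>R norm y"] \<open>y \<noteq> 0\<close> by simp
  moreover have "K 1 = k" by (simp add: K_def fun_eq_iff)
  moreover have "($) y = x" by (simp add: y_def fun_eq_iff)
  ultimately show ?thesis by (simp add: F_def)
qed

text \<open>For \<open>e = 0\<close> scaling is a null direction, so \<open>hess_pos\<close> cannot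
  extend; semidefiniteness is its limit as the parameter decreases to 0, and
  \<open>descartes\<close> only grows with the parameter.\<close>

lemma hess_nonneg:
  assumes e: "0 \<le> e" and k: "\<And>i. sqrt e < k i" and Q: "0 < descartes e k"
  shows "0 \<le> hess e k x x"
proof (cases "e = 0 \<and> x \<noteq> (\<lambda>_. 0)")
  case False
  then show ?thesis
    using hess_pos[of e k x] assms by (cases "x = (\<lambda>_. 0)") (auto simp: hess_def angle_form_def less_imp_le)
next
  case True
  then have k0: "0 < k i" for i using k[of i] by simp
  \<comment> \<open>Parameters below \<open>m\<^sup>2\<close> have a square root below every
    curvature, as \<open>hess_pos\<close> requires.\<close>
  define m where "m = Min (range k)"
  have m: "0 < m" "m \<le> k i" for i using k0 by (auto simp: m_def)
  have "continuous_on {0..} (\<lambda>e. hess e k x x)"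
    by (intro continuous_on_hess continuous_intros) (use less_imp_neq[OF face_curv_pos[OF _ k0]] in simp)
  then have "continuous_on (closure {0<..<m\<^sup>2}) (\<lambda>e. hess e k x x)"
    by (rule continuous_on_subset) (use m in auto)
  moreover have "0 \<in> closure {0<..<m\<^sup>2}" using m by simp
  moreover have "0 \<le> hess d k x x" if d: "d \<in> {0<..<m\<^sup>2}" for d
  proof -
    have "sqrt d < k i" for i
      using m(1) m(2)[of i] d real_sqrt_less_mono[of d "m\<^sup>2"] by simp
    moreover have "0 < descartes d k" using Q True d by (simp add: descartes_def)
    ultimately show ?thesis using hess_pos[of d k x] d True by (simp add: less_imp_le)
  qed
  ultimately have "0 \<le> hess 0 k x x" by (rule continuous_ge_on_closure)
  then show ?thesis using True by simp
qed

text \<open>With \<open>k = 1 / r\<close> and \<open>e = 0\<close> the conclusion reads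
  \<open>x = c * r\<close>, an infinitesimal scaling; for \<open>e > 0\<close> it forces
  \<open>x = 0\<close>.\<close>

lemma hess_eq_0_imp:
  assumes e: "0 \<le> e" and k: "\<And>i. sqrt e < k i" and Q: "0 < descartes e k" and x: "hess e k x x = 0"
  obtains c where "\<And>l. ((k l)\<^sup>2 - e) * x l = c * k l" "e * c = 0"
proof -
  have k0: "0 < k i" for i using k[of i] e by (meson le_less_trans real_sqrt_ge_zero)
  have "angle_form e k (\<lambda>i. ((k i)\<^sup>2 - e) * x i) l = 0" for l
    using hess_zero_imp_angle_form_zero[of e k x l] hess_nonneg[OF e k Q] less_imp_neq[OF face_curv_pos[OF e k0]] x
    by simp
  from angle_form_eq_0[OF less_imp_neq[OF Q, symmetric] this] that show ?thesis by blast
qed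

section \<open>Monotonicity of the face angles\<close>

text \<open>A drop from \<open>g a\<close> to \<open>g b\<close> would cross a whole interval of
  values avoiding \<open>F\<close>. During one downward crossing the derivative is nonnegative
  throughout, yet \<open>g\<close> falls.\<close>

lemma nondecreasing_off_finite_values:
  fixes g :: "real \<Rightarrow> real"
  assumes ab: "a \<le> b" and cont: "continuous_on {a..b} g" and F: "finite F"
    and der: "\<And>t. \<lbrakk>a \<le> t; t \<le> b; g t \<notin> F\<rbrakk> \<Longrightarrow> \<exists>d\<ge>0. (g has_real_derivative d) (at t)"
  shows "g a \<le> g b"
proof (rule ccontr)
  assume "\<not> g a \<le> g b"
  then have lt: "g b < g a" by simp
  have "infinite {g b<..<g a}" using lt by simp
  then have "\<not> {g b<..<g a} \<subseteq> F" using F finite_subset by blast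
  then obtain p where "p \<in> {g b<..<g a}" "p \<notin> F" by blast
  then have p: "g b < p" "p < g a" "p \<notin> F" by auto
  have "open ({g b<..<g a} - F)" using F by (intro open_Diff finite_imp_closed) auto
  then obtain \<epsilon> where \<epsilon>: "\<epsilon> > 0" "ball p \<epsilon> \<subseteq> {g b<..<g a} - F"
    using p by (meson DiffI greaterThanLessThan_iff openE)
  define c where "c = p - \<epsilon> / 2"
  define d where "d = p + \<epsilon> / 2"
  have cd: "c < d" using \<epsilon> by (simp add: c_def d_def)
  have sub: "{c..d} \<subseteq> {g b<..<g a} - F"
    by (rule order.trans[OF _ \<epsilon>(2)]) (use \<epsilon>(1) in \<open>auto simp: c_def d_def dist_real_def\<close>)
  have bc: "g b < c" "d < g a" using subsetD[OF sub, of c] subsetD[OF sub, of d] cd by auto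
  have cpt: "compact {t \<in> {u..v}. g t = y}" if "{u..v} \<subseteq> {a..b}" for u v y
  proof -
    have "closed {t \<in> {u..v}. g t = y}"
      by (rule continuous_closed_preimage_constant[OF continuous_on_subset[OF cont that]]) simp
    then have "compact ({u..v} \<inter> {t \<in> {u..v}. g t = y})" by (intro compact_Int_closed) auto
    moreover have "{u..v} \<inter> {t \<in> {u..v}. g t = y} = {t \<in> {u..v}. g t = y}" by auto
    ultimately show ?thesis by simp
  qed
  have ivt: "\<exists>t. u \<le> t \<and> t \<le> v \<and> g t = y" if "a \<le> u" "u \<le> v" "v \<le> b" "g v \<le> y" "y \<le> g u" for u v y
    using IVT2'[of g v y u] that continuous_on_subset[OF cont, of "{u..v}"] by auto
  have "{t \<in> {a..b}. g t = d} \<noteq> {}"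
    using ivt[of a b d] ab bc cd by auto
  \<comment> \<open>The last time at height \<open>d\<close>, followed by the first later time at
    height \<open>c\<close>: by the intermediate value theorem \<open>g\<close> stays in
    \<open>{c..d}\<close> in between.\<close>
  then obtain t1 where t1: "t1 \<in> {a..b}" "g t1 = d" "\<And>t. t \<in> {a..b} \<Longrightarrow> g t = d \<Longrightarrow> t \<le> t1"
    using compact_attains_sup[OF cpt[of a b d]] by auto
  have "{t \<in> {t1..b}. g t = c} \<noteq> {}"
    using ivt[of t1 b c] t1 bc cd by auto
  then obtain t2 where t2: "t2 \<in> {t1..b}" "g t2 = c" "\<And>t. t \<in> {t1..b} \<Longrightarrow> g t = c \<Longrightarrow> t2 \<le> t"
    using compact_attains_inf[OF cpt[of t1 b c]] t1(1) by auto
  have t12: "t1 < t2" using t1(2) t2(1,2) cd by (cases "t1 = t2") auto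
  have mid: "g t \<in> {c..d}" if t: "t1 < t" "t < t2" for t
  proof -
    have "g t \<le> d"
    proof (rule ccontr)
      assume "\<not> g t \<le> d"
      then obtain u where "t \<le> u" "u \<le> b" "g u = d" using ivt[of t b d] t t1(1) t2(1) bc cd by auto
      then show False using t1(1) t1(3)[of u] t by auto
    qed
    moreover have "c \<le> g t"
    proof (rule ccontr)
      assume "\<not> c \<le> g t"
      then obtain u where "t1 \<le> u" "u \<le> t" "g u = c"
        using ivt[of t1 t c] t t1(1,2) t2(1) cd by auto
      then show False using t2(1) t2(3)[of u] t by auto
    qed
    ultimately show ?thesis by simp
  qed
  have "g t1 \<le> g t2"
  proof (rule DERIV_nonneg_imp_increasing_open[where f = g])
    show "t1 \<le> t2" using t12 by simp
    fix t assume t: "t1 < t" "t < t2"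
    then have "g t \<notin> F" using mid sub by blast
    then show "\<exists>y. (g has_real_derivative y) (at t) \<and> 0 \<le> y"
      using der[of t] t t1(1) t2(1) by auto
  next
    show "continuous_on {t1..t2} g" using t1(1) t2(1) by (intro continuous_on_subset[OF cont]) auto
  qed
  then show False using t1(2) t2(2) cd by simp
qed

text \<open>The dihedral angle at an edge is \<open>pi\<close> minus the sum of the face angles of its two faces. The
  clamping extends the angle continuously, with values \<open>0\<close> and \<open>pi\<close>, to degenerate radii.\<close>

definition face_angle :: "real \<Rightarrow> (4 \<Rightarrow> real) \<Rightarrow> 4 \<Rightarrow> real" where
  "face_angle e k l = arccos (max (-1) (min 1 (slack k l / (2 * sqrt (face_curv e k l)))))"

section \<open>Face angles at nondegenerate and degenerate radii\<close>

lemma two_sqrt_face_curv: "2 * sqrt (face_curv e k l) = sqrt (descartes e k + (slack k l)\<^sup>2)"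
  by (simp add: face_curv_def real_sqrt_divide)

text \<open>Since four times \<open>face_curv\<close> is \<open>descartes\<close> plus the squared
  slack, the argument of \<open>arccos\<close> is the sine of the arctangent on the right. It lies
  inside the clamp, and the arctangent form is easy to differentiate.\<close>

lemma face_angle_arctan:
  assumes "0 < descartes e k"
  shows "face_angle e k l = pi / 2 - arctan (slack k l / sqrt (descartes e k))"
proof -
  define h m where "h = sqrt (descartes e k)" and "m = slack k l"
  have h: "0 < h" "descartes e k = h\<^sup>2" using assms by (auto simp: h_def)
  have eq: "2 * sqrt (face_curv e k l) = h * sqrt (1 + (m / h)\<^sup>2)"
  proof -
    have "h\<^sup>2 + m\<^sup>2 = h\<^sup>2 * (1 + (m / h)\<^sup>2)" using h(1) by (simp add: field_simps)
    then have "sqrt (h\<^sup>2 + m\<^sup>2) = h * sqrt (1 + (m / h)\<^sup>2)" using h(1) by (simp add: real_sqrt_mult)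
    then show ?thesis unfolding two_sqrt_face_curv h(2) m_def .
  qed
  have "m / (2 * sqrt (face_curv e k l)) = sin (arctan (m / h))"
    unfolding eq sin_arctan by simp
  also have "\<dots> = cos (pi / 2 - arctan (m / h))" by (simp add: cos_sin_eq)
  finally have *: "m / (2 * sqrt (face_curv e k l)) = cos (pi / 2 - arctan (m / h))" .
  have "face_angle e k l = arccos (cos (pi / 2 - arctan (m / h)))"
    unfolding face_angle_def m_def[symmetric] * by (simp add: max_absorb2 min_absorb2)
  also have "\<dots> = pi / 2 - arctan (m / h)"
    using arctan_bounded[of "m / h"] by (intro arccos_cos) auto
  finally show ?thesis by (simp add: m_def h_def)
qed

text \<open>Here four times \<open>face_curv\<close> is at most the squared slack, so the clamp
  sends the argument of \<open>arccos\<close> to -1 or 1.\<close>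

lemma face_angle_degenerate:
  assumes "descartes e k \<le> 0" "0 < face_curv e k l"
  shows "face_angle e k l \<in> {0, pi}"
proof -
  define x where "x = slack k l / (2 * sqrt (face_curv e k l))"
  have p: "0 < 2 * sqrt (face_curv e k l)" using assms(2) by simp
  have "(2 * sqrt (face_curv e k l))\<^sup>2 \<le> (slack k l)\<^sup>2"
    using assms by (simp add: power_mult_distrib less_imp_le) (simp add: face_curv_def)
  then have "1 \<le> x\<^sup>2" using p unfolding x_def power_divide by (simp add: field_simps)
  then have "1 \<le> \<bar>x\<bar>" by (simp add: abs_le_square_iff[of 1 x, simplified])
  then have "max (-1) (min 1 x) \<in> {-1, 1}" by (auto simp: abs_if split: if_splits)
  then show ?thesis unfolding face_angle_def x_def[symmetric] by auto
qed

lemma has_real_derivative_face_angle: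
  assumes k: "\<And>i. ((\<lambda>t. k t i) has_real_derivative - (((k t0 i)\<^sup>2 - e) * v i)) (at t0)"
    and Q: "0 < descartes e (k t0)"
  shows "((\<lambda>t. face_angle e (k t) l) has_real_derivative
     angle_form e (k t0) (\<lambda>i. ((k t0 i)\<^sup>2 - e) * v i) l / (4 * sqrt (descartes e (k t0)) * face_curv e (k t0) l)) (at t0)"
proof -
  define w where "w = (\<lambda>i. ((k t0 i)\<^sup>2 - e) * v i)"
  define D m h where "D = descartes e (k t0)" and "m = slack (k t0) l" and "h = sqrt D"
  define R where "R = (\<Sum>i\<in>UNIV. slack (k t0) i * w i)"
  have h: "0 < h" "D = h\<^sup>2" using Q by (auto simp: h_def D_def)
  have dsum: "((\<lambda>t. sum (k t) UNIV) has_real_derivative - sum w UNIV) (at t0)"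
  proof -
    have "((\<lambda>t. \<Sum>i\<in>UNIV. k t i) has_real_derivative (\<Sum>i\<in>UNIV. - w i)) (at t0)"
      by (rule DERIV_sum) (use k in \<open>simp add: w_def\<close>)
    then show ?thesis by (simp add: sum_negf)
  qed
  have dm: "((\<lambda>t. slack (k t) l) has_real_derivative - (sum w UNIV - 2 * w l)) (at t0)"
    unfolding slack_def by (rule derivative_eq_intros dsum k refl)+ (simp add: w_def)
  have dQ: "((\<lambda>t. descartes e (k t)) has_real_derivative - 2 * R) (at t0)"
  proof -
    have "((\<lambda>t. \<Sum>i\<in>UNIV. (k t i)\<^sup>2) has_real_derivative (\<Sum>i\<in>UNIV. - 2 * (k t0 i * w i))) (at t0)"
    proof (rule DERIV_sum)
      fix i show "((\<lambda>t. (k t i)\<^sup>2) has_real_derivative - 2 * (k t0 i * w i)) (at t0)"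
        by (rule derivative_eq_intros k refl)+ (simp add: w_def)
    qed
    note dsq = this
    have dQ0: "((\<lambda>t. descartes e (k t)) has_real_derivative
        2 * sum (k t0) UNIV * (- sum w UNIV) - 2 * (\<Sum>i\<in>UNIV. - 2 * (k t0 i * w i))) (at t0)"
      unfolding descartes_def by (rule dsum dsq derivative_eq_intros refl)+ simp
    have "R = sum (k t0) UNIV * sum w UNIV - 2 * (\<Sum>i\<in>UNIV. k t0 i * w i)"
      unfolding R_def slack_def by (simp add: left_diff_distrib sum_subtractf sum_distrib_left mult.assoc)
    then have "2 * sum (k t0) UNIV * (- sum w UNIV) - 2 * (\<Sum>i\<in>UNIV. - 2 * (k t0 i * w i)) = - 2 * R"
      by (simp add: sum_distrib_left[symmetric] sum_negf)
    then show ?thesis using dQ0 by simp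
  qed
  have fc: "face_curv e (k t0) l = (h\<^sup>2 + m\<^sup>2) / 4" by (simp add: face_curv_def h(2)[symmetric] D_def m_def)
  have "((\<lambda>t. pi / 2 - arctan (slack (k t) l / sqrt (descartes e (k t)))) has_real_derivative
      0 - inverse (1 + (m / h)\<^sup>2) * ((- (sum w UNIV - 2 * w l) * h - m * (- 2 * R * (inverse h / 2))) / (h * h))) (at t0)"
    by (rule derivative_eq_intros dm dQ refl | use Q in \<open>simp add: m_def h_def D_def\<close>)+
  also have "0 - inverse (1 + (m / h)\<^sup>2) * ((- (sum w UNIV - 2 * w l) * h - m * (- 2 * R * (inverse h / 2))) / (h * h))
      = angle_form e (k t0) w l / (4 * h * face_curv e (k t0) l)"
  proof -
    have "h\<^sup>2 + m\<^sup>2 > 0" using h(1) by (simp add: add_pos_nonneg)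
    then show ?thesis
      unfolding fc angle_form_def R_def[symmetric] D_def[symmetric] m_def[symmetric] h(2)
      using h(1) by (simp add: divide_simps) (simp add: algebra_simps power2_eq_square)
  qed
  finally have "((\<lambda>t. pi / 2 - arctan (slack (k t) l / sqrt (descartes e (k t)))) has_real_derivative
      angle_form e (k t0) w l / (4 * h * face_curv e (k t0) l)) (at t0)" .
  \<comment> \<open>Positivity of \<open>descartes\<close> persists near \<open>t0\<close>, so the
    arctangent form is valid on a neighbourhood and its derivative transfers.\<close>
  moreover have "\<forall>\<^sub>F t in nhds t0. face_angle e (k t) l = pi / 2 - arctan (slack (k t) l / sqrt (descartes e (k t)))"
  proof -
    have "((\<lambda>t. descartes e (k t)) \<longlongrightarrow> descartes e (k t0)) (at t0)"
      using DERIV_isCont[OF dQ] by (simp add: isCont_def)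
    then have "\<forall>\<^sub>F t in at t0. 0 < descartes e (k t)" using Q by (rule order_tendstoD)
    then have "\<forall>\<^sub>F t in nhds t0. 0 < descartes e (k t)" using Q by (simp add: eventually_nhds_conv_at)
    then show ?thesis by eventually_elim (rule face_angle_arctan)
  qed
  ultimately show ?thesis
    by (subst DERIV_cong_ev[OF refl _ refl]) (auto simp: w_def h_def D_def)
qed


lemma continuous_on_face_angle:
  assumes "\<And>i. continuous_on A (\<lambda>t. k t i)" "\<And>t. t \<in> A \<Longrightarrow> 0 < face_curv e (k t) l"
  shows "continuous_on A (\<lambda>t. face_angle e (k t) l)"
proof -
  have fc: "continuous_on A (\<lambda>t. face_curv e (k t) l)"
    unfolding face_curv_def descartes_def slack_def by (intro continuous_intros assms(1)) auto
  have q: "continuous_on A (\<lambda>t. slack (k t) l / (2 * sqrt (face_curv e (k t) l)))"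
    unfolding slack_def using assms(2) by (intro continuous_intros assms(1) fc) fastforce
  show ?thesis
    unfolding face_angle_def
    by (intro continuous_on_compose2[OF continuous_on_arccos'] continuous_on_max continuous_on_min
        continuous_on_const q) auto
qed

text \<open>\<open>f\<close> is the curvature of a sphere as a function of its radius, and
  \<open>D\<close> pairs the changes of the face angles with those of the semiperimeters. The
  segment from \<open>r\<close> to \<open>r'\<close> may run through degenerate radii, hence the
  appeal to \<open>nondecreasing_off_finite_values\<close>.\<close>

lemma face_angle_monotone:
  fixes f :: "real \<Rightarrow> real" and r r' :: "4 \<Rightarrow> real"
  assumes e: "0 \<le> e"
    and f: "\<And>x. 0 < x \<Longrightarrow> sqrt e < f x"
    and f': "\<And>x. 0 < x \<Longrightarrow> (f has_real_derivative - ((f x)\<^sup>2 - e)) (at x)"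
    and r: "\<And>i. 0 < r i" and r': "\<And>i. 0 < r' i"
    and Q: "0 < descartes e (\<lambda>i. f (r i))"
  defines "v \<equiv> \<lambda>i. r' i - r i"
  defines "D \<equiv> (\<Sum>l\<in>UNIV. (face_angle e (\<lambda>i. f (r' i)) l - face_angle e (\<lambda>i. f (r i)) l) * (sum v UNIV - v l))"
  shows "0 \<le> D" and "D = 0 \<Longrightarrow> hess e (\<lambda>i. f (r i)) v v = 0"
proof -
  define K where "K t i = f (r i + t * v i)" for t i
  define Y where "Y l = sum v UNIV - v l" for l
  define g where "g t = (\<Sum>l\<in>UNIV. face_angle e (K t) l * Y l)" for t
  have pos: "0 < r i + t * v i" if "t \<in> {0..1}" for t i
  proof -
    have "r i + t * v i = (1 - t) * r i + t * r' i" by (simp add: v_def algebra_simps)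
    moreover have "0 < (1 - t) * r i + t * r' i"
      using convex_bound_lt[of "- r i" 0 "- r' i" "1 - t" t] r[of i] r'[of i] that by simp
    ultimately show ?thesis by simp
  qed
  have K: "sqrt e < K t i" "0 < K t i" if "t \<in> {0..1}" for t i
    using f[OF pos[OF that, of i]] le_less_trans[OF real_sqrt_ge_zero[OF e]] by (auto simp: K_def)
  have dK: "((\<lambda>t. K t i) has_real_derivative - (((K t i)\<^sup>2 - e) * v i)) (at t)" if "t \<in> {0..1}" for t i
  proof -
    have "((\<lambda>t. f (r i + t * v i)) has_real_derivative (- ((f (r i + t * v i))\<^sup>2 - e)) * v i) (at t)"
      by (rule DERIV_chain2[where f = f and g = "\<lambda>t. r i + t * v i", OF f'[OF pos[OF that]]])
        (auto intro!: derivative_eq_intros)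
    then show ?thesis by (simp add: K_def algebra_simps)
  qed
  have fc: "0 < face_curv e (K t) l" if "t \<in> {0..1}" for t l
    using face_curv_pos[OF e K(2)[OF that]] .
  have contK: "continuous_on {0..1} (\<lambda>t. K t i)" for i
    using DERIV_isCont[OF dK] by (intro continuous_at_imp_continuous_on) blast
  have contg: "continuous_on {0..1} g"
    unfolding g_def by (intro continuous_intros continuous_on_face_angle contK fc)
  have dg: "(g has_real_derivative hess e (K t) v v / (4 * sqrt (descartes e (K t)))) (at t)"
    if t: "t \<in> {0..1}" and Qt: "0 < descartes e (K t)" for t
  proof -
    have "(g has_real_derivative (\<Sum>l\<in>UNIV. angle_form e (K t) (\<lambda>i. ((K t i)\<^sup>2 - e) * v i) l
        / (4 * sqrt (descartes e (K t)) * face_curv e (K t) l) * Y l)) (at t)"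
      unfolding g_def
      by (intro DERIV_sum DERIV_cmult_right has_real_derivative_face_angle dK[OF t] Qt)
    moreover have "(\<Sum>l\<in>UNIV. angle_form e (K t) (\<lambda>i. ((K t i)\<^sup>2 - e) * v i) l
        / (4 * sqrt (descartes e (K t)) * face_curv e (K t) l) * Y l) = hess e (K t) v v / (4 * sqrt (descartes e (K t)))"
      unfolding hess_def Y_def sum_divide_distrib by (rule sum.cong) simp_all
    ultimately show ?thesis by simp
  qed
  have hess0: "0 \<le> hess e (K t) v v" if "t \<in> {0..1}" "0 < descartes e (K t)" for t
    using hess_nonneg[OF e K(1) that(2)] that(1) by blast
  \<comment> \<open>The values of \<open>g\<close> when every face angle is 0 or \<open>pi\<close>,
    one for each set of faces with angle \<open>pi\<close>.\<close>
  define F where "F = (\<lambda>A. \<Sum>l\<in>UNIV. (if l \<in> A then pi else 0) * Y l) ` (UNIV :: 4 set set)"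
  have step: "\<exists>d\<ge>0. (g has_real_derivative d) (at t)" if t: "t \<in> {0..1}" and nF: "g t \<notin> F" for t
  proof -
    have "0 < descartes e (K t)"
    proof (rule ccontr)
      assume "\<not> 0 < descartes e (K t)"
      then have dg: "face_angle e (K t) l \<in> {0, pi}" for l
        using face_angle_degenerate[of e "K t" l] fc[OF t] by auto
      define A where "A = {l. face_angle e (K t) l = pi}"
      have "face_angle e (K t) l = (if l \<in> A then pi else 0)" for l
        using dg[of l] by (auto simp: A_def)
      then have "g t = (\<Sum>l\<in>UNIV. (if l \<in> A then pi else 0) * Y l)" by (simp add: g_def)
      then show False using nF unfolding F_def by blast
    qed
    then show ?thesis
      by (intro exI[of _ "hess e (K t) v v / (4 * sqrt (descartes e (K t)))"] conjI dg[OF t])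
        (simp add: hess0[OF t] less_imp_le)
  qed
  have mono: "g a \<le> g 1" if "a \<in> {0..1}" for a
    using that by (intro nondecreasing_off_finite_values[of a 1 g F] step continuous_on_subset[OF contg])
      (auto simp: F_def)
  have "K 0 = (\<lambda>i. f (r i))" "K 1 = (\<lambda>i. f (r' i))" by (simp_all add: K_def v_def fun_eq_iff)
  note K01 = this
  have D: "D = g 1 - g 0"
    unfolding D_def g_def K01 Y_def by (simp add: left_diff_distrib sum_subtractf)
  show "0 \<le> D" using D mono[of 0] by simp
  show "hess e (\<lambda>i. f (r i)) v v = 0" if "D = 0"
  proof (rule ccontr)
    assume "hess e (\<lambda>i. f (r i)) v v \<noteq> 0"
    then have "0 < hess e (K 0) v v" using hess0[of 0] Q by (simp add: K01)
    then have "0 < hess e (K 0) v v / (4 * sqrt (descartes e (K 0)))" using Q by (simp add: K01)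
    \<comment> \<open>A form positive at the start makes \<open>g\<close> rise strictly at once, and
      monotonicity prevents it from falling back.\<close>
    then obtain d where d: "0 < d" "\<And>h. 0 < h \<Longrightarrow> h < d \<Longrightarrow> g 0 < g (0 + h)"
      using DERIV_pos_inc_right[OF dg[of 0]] Q K01 by auto
    define h where "h = min (d / 2) 1"
    have "0 < h" "h < d" "h \<le> 1" using d(1) by (auto simp: h_def)
    then have "g 0 < g 1" using d(2)[of h] mono[of h] by simp
    then show False using that D by simp
  qed
qed

section \<open>Angles of the tetrahedron of centres\<close>

lemma sum_distinct4:
  assumes "distinct [a, b, c, d :: 4]"
  shows "sum f UNIV = f a + f b + f c + f d"
proof -
  have "{a, b, c, d} = UNIV"
    using assms by (intro card_subset_eq) auto
  then have "sum f UNIV = sum f {a, b, c, d}" by simp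
  then show ?thesis using assms by (simp add: add.assoc)
qed

lemma face_curv_distinct4:
  assumes "distinct [a, b, c, d]"
  shows "face_curv e k d = k a * k b + k a * k c + k b * k c + e"
  by (simp add: face_curv_def descartes_def slack_def sum_distinct4[OF assms] power2_eq_square algebra_simps)

text \<open>By the addition formula the quotient is the cosine of a sum of two arctangents;
  positivity of the slack sum puts that sum in \<open>{0..pi}\<close>, where \<open>arccos\<close>
  inverts the cosine.\<close>

lemma arccos_face_angles:
  assumes Q: "0 < descartes e k" and m: "0 < slack k c + slack k d"
  shows "arccos ((descartes e k - slack k c * slack k d) / (4 * sqrt (face_curv e k c) * sqrt (face_curv e k d)))
    = pi - face_angle e k c - face_angle e k d"
proof -
  define h where "h = sqrt (descartes e k)"
  define x where "x = slack k c / h"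
  define y where "y = slack k d / h"
  have h: "0 < h" "descartes e k = h\<^sup>2" using Q by (auto simp: h_def)
  have xy: "slack k c = h * x" "slack k d = h * y" using h(1) by (auto simp: x_def y_def)
  have fc: "2 * sqrt (face_curv e k c) = h * sqrt (1 + x\<^sup>2)" "2 * sqrt (face_curv e k d) = h * sqrt (1 + y\<^sup>2)"
  proof -
    have "sqrt (h\<^sup>2 + (h * z)\<^sup>2) = h * sqrt (1 + z\<^sup>2)" for z
    proof -
      have "h\<^sup>2 + (h * z)\<^sup>2 = h\<^sup>2 * (1 + z\<^sup>2)" by (simp add: algebra_simps power_mult_distrib)
      then show ?thesis using h(1) by (simp add: real_sqrt_mult)
    qed
    then show "2 * sqrt (face_curv e k c) = h * sqrt (1 + x\<^sup>2)" "2 * sqrt (face_curv e k d) = h * sqrt (1 + y\<^sup>2)"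
      unfolding two_sqrt_face_curv h(2) xy by blast+
  qed
  have "4 * sqrt (face_curv e k c) * sqrt (face_curv e k d) = (2 * sqrt (face_curv e k c)) * (2 * sqrt (face_curv e k d))"
    by simp
  also have "\<dots> = h\<^sup>2 * (sqrt (1 + x\<^sup>2) * sqrt (1 + y\<^sup>2))" unfolding fc by (simp add: power2_eq_square)
  finally have den: "4 * sqrt (face_curv e k c) * sqrt (face_curv e k d) = h\<^sup>2 * (sqrt (1 + x\<^sup>2) * sqrt (1 + y\<^sup>2))" .
  have num: "descartes e k - slack k c * slack k d = h\<^sup>2 * (1 - x * y)"
    unfolding h(2) xy by (simp add: algebra_simps power2_eq_square)
  have "cos (arctan x + arctan y) = (1 - x * y) / (sqrt (1 + x\<^sup>2) * sqrt (1 + y\<^sup>2))"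
    unfolding cos_add cos_arctan sin_arctan by (simp add: diff_divide_distrib)
  then have "(descartes e k - slack k c * slack k d) / (4 * sqrt (face_curv e k c) * sqrt (face_curv e k d))
     = cos (arctan x + arctan y)"
    unfolding den num using h(1) by simp
  moreover have "arccos (cos (arctan x + arctan y)) = arctan x + arctan y"
  proof (rule arccos_cos)
    have "- y \<le> x" using m h(1) unfolding xy by (simp add: distrib_left[symmetric] zero_less_mult_iff)
    then have "arctan (- y) \<le> arctan x" by (simp only: arctan_le_iff)
    then show "0 \<le> arctan x + arctan y" by (simp add: arctan_minus)
    show "arctan x + arctan y \<le> pi" using arctan_ubound[of x] arctan_ubound[of y] by linarith
  qed
  ultimately show ?thesis
    unfolding face_angle_arctan[OF Q] h_def[symmetric] x_def[symmetric] y_def[symmetric] by simp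
qed

text \<open>The Gram matrix of the three edge vectors at vertex \<open>a\<close> of the tetrahedron of centres, common
  to both geometries; \<open>u a\<close> is irrelevant.\<close>

locale packed_cone =
  fixes B :: "'a::real_vector \<Rightarrow> 'a \<Rightarrow> real" and u :: "4 \<Rightarrow> 'a" and s k :: "4 \<Rightarrow> real" and e :: real and a :: 4
  assumes bil: "bilinear B" and sym: "\<And>x y. B x y = B y x"
    and e: "0 \<le> e" and k: "\<And>i. 0 < k i" and s: "\<And>i. 0 < s i" and q: "e < (k a)\<^sup>2"
    and diag: "\<And>x. x \<noteq> a \<Longrightarrow> B (u x) (u x) = (s x)\<^sup>2 * (k a + k x)\<^sup>2"
    and offdiag: "\<And>x y z. distinct [a, x, y, z] \<Longrightarrow>
        B (u x) (u y) = s x * s y * (face_curv e k z - ((k a)\<^sup>2 - e))"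
begin

text \<open>The numerator of the cosine of the dihedral angle at the edge from \<open>a\<close> to
  \<open>b\<close>. With the norms from \<open>orth_diag\<close>, the quotient reduces to the one in
  \<open>arccos_face_angles\<close>.\<close>

lemma orth_offdiag:
  assumes d: "distinct [a, b, c, d]"
  shows "B (orth_part B (u b) (u c)) (orth_part B (u b) (u d)) =
    s c * s d * ((k a)\<^sup>2 - e) * (descartes e k - slack k c * slack k d) / (k a + k b)\<^sup>2"
proof -
  have p: "k a + k b > 0" "s b > 0" using k[of a] k[of b] s by auto
  have "B (u c) (u b) = s c * s b * (face_curv e k d - ((k a)\<^sup>2 - e))"
    "B (u d) (u b) = s d * s b * (face_curv e k c - ((k a)\<^sup>2 - e))"
    "B (u c) (u d) = s c * s d * (face_curv e k b - ((k a)\<^sup>2 - e))"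
    using d by (auto intro!: offdiag)
  moreover have "face_curv e k d = k a * k b + k a * k c + k b * k c + e"
    "face_curv e k c = k a * k b + k a * k d + k b * k d + e"
    "face_curv e k b = k a * k c + k a * k d + k c * k d + e"
    using d face_curv_distinct4[of a b c d] face_curv_distinct4[of a b d c] face_curv_distinct4[of a c d b]
    by auto
  moreover have "descartes e k - slack k c * slack k d = 2 * ((k a * k b + k a * k c + k b * k c + e)
      + (k a * k b + k a * k d + k b * k d + e) - (k a + k b)\<^sup>2)"
    by (simp add: descartes_def slack_def sum_distinct4[OF d] power2_eq_square algebra_simps)
  moreover have "B (u b) (u b) = (s b)\<^sup>2 * (k a + k b)\<^sup>2" using d by (intro diag) auto
  ultimately show ?thesis
    unfolding inner_orth_part[OF bil sym]
    using p by (simp add: divide_simps) (simp add: power2_eq_square algebra_simps)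
qed

lemma orth_diag:
  assumes d: "distinct [a, b, c, d]"
  shows "B (orth_part B (u b) (u c)) (orth_part B (u b) (u c)) =
    4 * (s c)\<^sup>2 * ((k a)\<^sup>2 - e) * face_curv e k d / (k a + k b)\<^sup>2"
proof -
  have p: "k a + k b > 0" "s b > 0" using k[of a] k[of b] s by auto
  have "B (u c) (u b) = s c * s b * (face_curv e k d - ((k a)\<^sup>2 - e))"
    using d by (auto intro!: offdiag)
  moreover have "face_curv e k d = k a * k b + k a * k c + k b * k c + e"
    by (rule face_curv_distinct4[OF d])
  moreover have "B (u b) (u b) = (s b)\<^sup>2 * (k a + k b)\<^sup>2" "B (u c) (u c) = (s c)\<^sup>2 * (k a + k c)\<^sup>2"
    using d by (auto intro!: diag)
  ultimately show ?thesis
    unfolding inner_orth_part[OF bil sym]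
    using p by (simp add: divide_simps) (simp add: power2_eq_square algebra_simps)
qed

lemma slack_add_pos:
  assumes d: "distinct [a, b, c, d]"
  shows "0 < slack k c + slack k d"
  using k[of a] k[of b] by (simp add: slack_def sum_distinct4[OF d])

text \<open>Strict Cauchy-Schwarz for two edges projected orthogonally to the third. With
  \<open>Q\<close> for \<open>descartes\<close> and slacks \<open>m\<close>, \<open>n\<close> it
  reads \<open>(Q - m * n)\<^sup>2 < (Q + m\<^sup>2) * (Q + n\<^sup>2)\<close>, that is
  \<open>0 < Q * (m + n)\<^sup>2\<close>.\<close>

lemma descartes_pos:
  assumes d: "distinct [a, b, c, d]"
    and pos: "\<And>x y z. x \<noteq> 0 \<or> y \<noteq> 0 \<Longrightarrow>
      0 < B (x *\<^sub>R u c + y *\<^sub>R u d + z *\<^sub>R u b) (x *\<^sub>R u c + y *\<^sub>R u d + z *\<^sub>R u b)"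
  shows "0 < descartes e k"
proof -
  define v where "v = orth_part B (u b) (u c)"
  define w where "w = orth_part B (u b) (u d)"
  have quad: "0 < x\<^sup>2 * B v v + 2 * x * y * B v w + y\<^sup>2 * B w w" if "x \<noteq> 0 \<or> y \<noteq> 0" for x y
  proof -
    have "x *\<^sub>R v + y *\<^sub>R w = x *\<^sub>R u c + y *\<^sub>R u d
        + (- x * (B (u c) (u b) / B (u b) (u b)) - y * (B (u d) (u b) / B (u b) (u b))) *\<^sub>R u b"
      by (simp add: v_def w_def orth_part_def algebra_simps)
    then have "0 < B (x *\<^sub>R v + y *\<^sub>R w) (x *\<^sub>R v + y *\<^sub>R w)"
      using pos[OF that] by metis
    then show ?thesis
      using bil by (simp add: bilinear_ladd bilinear_radd bilinear_lmul bilinear_rmul sym[of w v]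
          power2_eq_square algebra_simps)
  qed
  have w: "0 < B w w" using quad[of 0 1] by simp
  \<comment> \<open>These coefficients turn the quadratic form into \<open>B w w\<close> times the
    Gram determinant.\<close>
  have "0 < B w w * (B v v * B w w - (B v w)\<^sup>2)"
    using quad[of "B w w" "- B v w"] w by (simp add: power2_eq_square algebra_simps)
  then have cs: "(B v w)\<^sup>2 < B v v * B w w" using w by (simp add: zero_less_mult_iff)
  define f where "f = s c * s d * ((k a)\<^sup>2 - e) / (k a + k b)\<^sup>2"
  have f: "0 < f" using s[of c] s[of d] q k[of a] k[of b] by (simp add: f_def)
  have d': "distinct [a, b, d, c]" using d by auto
  have vw: "B v w = f * (descartes e k - slack k c * slack k d)"
    unfolding v_def w_def orth_offdiag[OF d] f_def by simp
  have "B v v * B w w = f\<^sup>2 * ((4 * face_curv e k d) * (4 * face_curv e k c))"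
    unfolding v_def w_def orth_diag[OF d] orth_diag[OF d'] f_def
    by (simp add: power_divide power_mult_distrib) (simp add: power2_eq_square)
  then have "(descartes e k - slack k c * slack k d)\<^sup>2 < (4 * face_curv e k d) * (4 * face_curv e k c)"
    using cs f unfolding vw power_mult_distrib by (simp add: mult_less_cancel_left)
  then have "0 < descartes e k * (slack k c + slack k d)\<^sup>2"
    by (simp add: face_curv_def power2_eq_square algebra_simps)
  then show ?thesis using slack_add_pos[OF d] by (simp add: zero_less_mult_iff)
qed

lemma dihedral_angle_eq:
  assumes d: "distinct [a, b, c, d]" and Q: "0 < descartes e k"
  shows "dihedral_angle B (u b) (u c) (u d) = pi - face_angle e k c - face_angle e k d"
proof -
  define g where "g = sqrt ((k a)\<^sup>2 - e) / (k a + k b)"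
  have p: "0 < (k a)\<^sup>2 - e" "0 < k a + k b" using q k[of a] k[of b] by auto
  have g: "0 < g" "g\<^sup>2 = ((k a)\<^sup>2 - e) / (k a + k b)\<^sup>2" using p by (auto simp: g_def power_divide)
  have d': "distinct [a, b, d, c]" using d by auto
  have norm: "sqrt (4 * (s x)\<^sup>2 * ((k a)\<^sup>2 - e) * y / (k a + k b)\<^sup>2) = 2 * s x * g * sqrt y" for x y
  proof -
    have "4 * (s x)\<^sup>2 * ((k a)\<^sup>2 - e) * y / (k a + k b)\<^sup>2 = (2 * s x * g)\<^sup>2 * y"
      unfolding power_mult_distrib g(2) by simp
    then show ?thesis using s[of x] g(1) by (simp add: real_sqrt_mult)
  qed
  have "dihedral_angle B (u b) (u c) (u d) = arccos (s c * s d * ((k a)\<^sup>2 - e) * (descartes e k - slack k c * slack k d) / (k a + k b)\<^sup>2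
     / ((2 * s c * g * sqrt (face_curv e k d)) * (2 * s d * g * sqrt (face_curv e k c))))"
    unfolding dihedral_angle_def angle_between_def orth_offdiag[OF d] orth_diag[OF d] orth_diag[OF d'] norm ..
  also have "s c * s d * ((k a)\<^sup>2 - e) * (descartes e k - slack k c * slack k d) / (k a + k b)\<^sup>2
      = (s c * s d * g\<^sup>2) * (descartes e k - slack k c * slack k d)"
    unfolding g(2) by simp
  also have "(2 * s c * g * sqrt (face_curv e k d)) * (2 * s d * g * sqrt (face_curv e k c))
      = (s c * s d * g\<^sup>2) * (4 * sqrt (face_curv e k c) * sqrt (face_curv e k d))"
    by (simp add: power2_eq_square)
  also have "(s c * s d * g\<^sup>2) * (descartes e k - slack k c * slack k d) /
      ((s c * s d * g\<^sup>2) * (4 * sqrt (face_curv e k c) * sqrt (face_curv e k d))) =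
      (descartes e k - slack k c * slack k d) / (4 * sqrt (face_curv e k c) * sqrt (face_curv e k d))"
    using s[of c] s[of d] g(1) by simp
  also have "arccos \<dots> = pi - face_angle e k c - face_angle e k d"
    by (rule arccos_face_angles[OF Q slack_add_pos[OF d]])
  finally show ?thesis .
qed

text \<open>Each of the three faces through \<open>a\<close> contains two of the three edges at
  \<open>a\<close>, so its face angle is subtracted twice; the face opposite to \<open>a\<close>
  does not enter.\<close>

lemma cone_solid_angle_eq:
  assumes d: "distinct [a, b, c, d]" and Q: "0 < descartes e k"
  shows "cone_solid_angle B (u b) (u c) (u d) = 2 * pi + 2 * (face_angle e k a - sum (face_angle e k) UNIV)"
  using d dihedral_angle_eq[OF _ Q, of b c d] dihedral_angle_eq[OF _ Q, of c d b] dihedral_angle_eq[OF _ Q, of d b c]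
  unfolding cone_solid_angle_def sum_distinct4[OF d] by auto

end

lemma distinct4_exists:
  fixes a :: 4
  obtains b c d where "distinct [a, b, c, d]"
proof -
  have "card (UNIV - {a}) = 3" by simp
  then obtain b c d where *: "UNIV - {a} = {b, c, d}" "b \<noteq> c" "b \<noteq> d" "c \<noteq> d" unfolding card_3_iff by blast
  then have "a \<noteq> b" "a \<noteq> c" "a \<noteq> d" by auto
  with * show ?thesis using that[of b c d] by auto
qed

lemma range_distinct4:
  assumes "distinct [a, b, c, d :: 4]"
  shows "range f = {f a, f b, f c, f d}"
proof -
  have "{a, b, c, d} = UNIV" using assms by (intro card_subset_eq) auto
  then have "range f = f ` {a, b, c, d}" by simp
  then show ?thesis by simp
qed

section \<open>Realisation in the two geometries\<close>

lemma euclidean_packed_tetrahedron: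
  fixes p :: "'v \<Rightarrow> real^3" and \<iota> :: "4 \<Rightarrow> 'v"
  assumes p: "euclidean_tetrahedron (edge_length r) W p"
    and \<iota>: "bij_betw \<iota> UNIV W" and r: "\<And>x. 0 < r (\<iota> x)"
  shows "0 < descartes 0 (\<lambda>x. 1 / r (\<iota> x))"
    and "euclidean_solid_angle (edge_length r) W (\<iota> a) =
      2 * pi + 2 * (face_angle 0 (\<lambda>x. 1 / r (\<iota> x)) a - sum (face_angle 0 (\<lambda>x. 1 / r (\<iota> x))) UNIV)"
proof -
  define k where "k = (\<lambda>x. 1 / r (\<iota> x))"
  have W: "W = range \<iota>" and inj: "inj \<iota>" using \<iota> by (auto simp: bij_betw_def)
  have dist: "dist (p (\<iota> x)) (p (\<iota> y)) = r (\<iota> x) + r (\<iota> y)" if "x \<noteq> y" for x y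
    using p that injD[OF inj, of x y] by (auto simp: euclidean_tetrahedron_def edge_length_def W)
  define u where "u a x = p (\<iota> x) - p (\<iota> a)" for a x
  \<comment> \<open>The scale \<open>r (\<iota> a) * r (\<iota> x)\<close> clears the denominators
    of the curvatures.\<close>
  have cone: "packed_cone (\<bullet>) (u a) (\<lambda>x. r (\<iota> a) * r (\<iota> x)) k 0 a" for a
  proof
    show "bilinear (\<lambda>x y :: real^3. x \<bullet> y)"
      using bounded_bilinear_inner by (simp add: bilinear_conv_bounded_bilinear)
    show "0 < k i" for i using r by (simp add: k_def)
    show "0 < r (\<iota> a) * r (\<iota> i)" for i using r by simp
    show "0 < (k a)\<^sup>2" using r[of a] by (simp add: k_def)
    fix x assume "x \<noteq> a"
    then have "u a x \<bullet> u a x = (r (\<iota> x) + r (\<iota> a))\<^sup>2"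
      using dist[of x a] by (simp add: u_def dist_norm power2_norm_eq_inner[symmetric])
    also have "r (\<iota> x) + r (\<iota> a) = (r (\<iota> a) * r (\<iota> x)) * (k a + k x)"
      using r[of a] r[of x] by (simp add: k_def field_simps)
    also have "\<dots>\<^sup>2 = (r (\<iota> a) * r (\<iota> x))\<^sup>2 * (k a + k x)\<^sup>2" by (rule power_mult_distrib)
    finally show "u a x \<bullet> u a x = (r (\<iota> a) * r (\<iota> x))\<^sup>2 * (k a + k x)\<^sup>2" .
  next
    fix x y z assume d: "distinct [a, x, y, z]"
    have polar: "u a x \<bullet> u a y = ((dist (p (\<iota> x)) (p (\<iota> a)))\<^sup>2 + (dist (p (\<iota> y)) (p (\<iota> a)))\<^sup>2
        - (dist (p (\<iota> x)) (p (\<iota> y)))\<^sup>2) / 2"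
      by (simp add: u_def dist_norm power2_norm_eq_inner inner_diff_left inner_diff_right inner_commute)
    also have "\<dots> = ((r (\<iota> x) + r (\<iota> a))\<^sup>2 + (r (\<iota> y) + r (\<iota> a))\<^sup>2 - (r (\<iota> x) + r (\<iota> y))\<^sup>2) / 2"
    proof -
      have "x \<noteq> a" "y \<noteq> a" "x \<noteq> y" using d by auto
      then show ?thesis by (simp add: dist)
    qed
    also have "\<dots> = r (\<iota> a) * r (\<iota> x) * (r (\<iota> a) * r (\<iota> y)) * (face_curv 0 k z - ((k a)\<^sup>2 - 0))"
      using r[of a] r[of x] r[of y] unfolding face_curv_distinct4[OF d] k_def
      by (simp add: field_simps power2_eq_square)
    finally show "u a x \<bullet> u a y = r (\<iota> a) * r (\<iota> x) * (r (\<iota> a) * r (\<iota> y)) * (face_curv 0 k z - ((k a)\<^sup>2 - 0))" .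
  qed (simp_all add: inner_commute)
  have pos: "0 < descartes 0 k"
  proof -
    have inj': "inj (p \<circ> \<iota>)"
      using p inj by (intro comp_inj_on) (auto simp: euclidean_tetrahedron_def W)
    have pne: "p (\<iota> x) \<noteq> p (\<iota> y)" if "x \<noteq> y" for x y using injD[OF inj', of x y] that by auto
    have 4: "(UNIV :: 4 set) = {1, 2, 3, 4}" by (rule UNIV_4)
    have pW: "p ` W = insert (p (\<iota> 1)) {p (\<iota> 2), p (\<iota> 3), p (\<iota> 4)}"
      unfolding W 4 by auto
    have "\<not> affine_dependent (insert (p (\<iota> 1)) {p (\<iota> 2), p (\<iota> 3), p (\<iota> 4)})"
      using p unfolding pW[symmetric] by (simp add: euclidean_tetrahedron_def)
    \<comment> \<open>Translating vertex 1 to the origin turns affine independence of the vertices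
      into linear independence of the edge vectors.\<close>
    then have ind: "independent ((\<lambda>x. - p (\<iota> 1) + x) ` {p (\<iota> 2), p (\<iota> 3), p (\<iota> 4)})"
      by (subst (asm) affine_dependent_iff_dependent) (use pne in auto)
    have ims: "(\<lambda>x. - p (\<iota> 1) + x) ` {p (\<iota> 2), p (\<iota> 3), p (\<iota> 4)} = {u 1 2, u 1 3, u 1 4}"
      by (auto simp: u_def)
    have une: "u 1 2 \<noteq> u 1 3" "u 1 2 \<noteq> u 1 4" "u 1 3 \<noteq> u 1 4" by (simp_all add: u_def pne)
    show ?thesis
    proof (rule packed_cone.descartes_pos[OF cone[of 1], of 2 3 4])
      fix x y z :: real assume xy: "x \<noteq> 0 \<or> y \<noteq> 0"
      have "x *\<^sub>R u 1 3 + y *\<^sub>R u 1 4 + z *\<^sub>R u 1 2 \<noteq> 0"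
      proof
        assume 0: "x *\<^sub>R u 1 3 + y *\<^sub>R u 1 4 + z *\<^sub>R u 1 2 = 0"
        define f where "f v = (if v = u 1 3 then x else if v = u 1 4 then y else z)" for v
        have "(\<Sum>v\<in>{u 1 2, u 1 3, u 1 4}. f v *\<^sub>R v) = 0"
          using 0 une by (simp add: f_def add_ac)
        then have "\<forall>v\<in>{u 1 2, u 1 3, u 1 4}. f v = 0"
          using ind unfolding ims by (subst (asm) independent_explicit_finite_subsets) auto
        then show False using xy une by (auto simp: f_def)
      qed
      then show "0 < (x *\<^sub>R u 1 3 + y *\<^sub>R u 1 4 + z *\<^sub>R u 1 2) \<bullet> (x *\<^sub>R u 1 3 + y *\<^sub>R u 1 4 + z *\<^sub>R u 1 2)"
        by (rule inner_gt_zero_iff[THEN iffD2])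
    qed simp
  qed
  then show "0 < descartes 0 (\<lambda>x. 1 / r (\<iota> x))" by (simp add: k_def)
  obtain b c d where d: "distinct [a, b, c, d]" by (rule distinct4_exists)
  have "W = {\<iota> a, \<iota> b, \<iota> c, \<iota> d}" "card W = 4"
    unfolding W using range_distinct4[OF d] card_image[OF inj] by simp_all
  then have "euclidean_solid_angle (edge_length r) W (\<iota> a) = cone_solid_angle (\<bullet>) (u a b) (u a c) (u a d)"
    unfolding u_def by (rule euclidean_solid_angle_eq[OF p])
  also have "\<dots> = 2 * pi + 2 * (face_angle 0 k a - sum (face_angle 0 k) UNIV)"
    by (rule packed_cone.cone_solid_angle_eq[OF cone d pos])
  finally show "euclidean_solid_angle (edge_length r) W (\<iota> a) =
      2 * pi + 2 * (face_angle 0 (\<lambda>x. 1 / r (\<iota> x)) a - sum (face_angle 0 (\<lambda>x. 1 / r (\<iota> x))) UNIV)"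
    by (simp only: k_def)
qed


text \<open>For time parts \<open>s\<close>, \<open>t\<close> and space parts \<open>a\<close>,
  \<open>c\<close> of \<open>p\<close>, \<open>z\<close>, orthogonality means
  \<open>c \<bullet> a = s * t\<close>. As \<open>s\<^sup>2 = 1 + (norm a)\<^sup>2\<close>,
  Cauchy-Schwarz makes the space part of \<open>z\<close> dominate strictly.\<close>

lemma lorentz_tangent_pos:
  assumes p: "p \<in> hyperbolic_space" and z: "lorentz z p = 0" "z \<noteq> 0"
  shows "0 < lorentz z z"
proof -
  obtain s a t c where pz: "p = (s, a)" "z = (t, c)" by force
  have s: "0 < s" "s\<^sup>2 = 1 + (norm a)\<^sup>2"
    using p by (auto simp: hyperbolic_space_def lorentz_def pz power2_norm_eq_inner power2_eq_square[of s])
  have ca: "c \<bullet> a = s * t" using z(1) by (simp add: lorentz_def pz mult.commute)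
  have c: "c \<noteq> 0" using ca s(1) z(2) by (auto simp: pz zero_prod_def)
  have "(s * t)\<^sup>2 \<le> (norm c * norm a)\<^sup>2"
    using Cauchy_Schwarz_ineq2[of c a] by (simp add: ca[symmetric] abs_le_square_iff[symmetric])
  also have "\<dots> = (norm c)\<^sup>2 * (s\<^sup>2 - 1)" by (simp add: power_mult_distrib s(2))
  also have "\<dots> < (norm c)\<^sup>2 * s\<^sup>2" using c by (simp add: mult_less_cancel_left)
  finally have "s\<^sup>2 * t\<^sup>2 < s\<^sup>2 * (norm c)\<^sup>2" by (simp add: power_mult_distrib mult.commute)
  then have "t\<^sup>2 < (norm c)\<^sup>2" using s(1) by (simp add: mult_less_cancel_left)
  then show ?thesis by (simp add: lorentz_def pz power2_norm_eq_inner power2_eq_square[of t])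
qed

lemma hyperbolic_packed_tetrahedron:
  fixes p :: "'v \<Rightarrow> real \<times> (real^3)" and \<iota> :: "4 \<Rightarrow> 'v"
  assumes p: "hyperbolic_tetrahedron (edge_length r) W p"
    and \<iota>: "bij_betw \<iota> UNIV W" and r: "\<And>x. 0 < r (\<iota> x)"
  defines "k \<equiv> \<lambda>x. cosh (r (\<iota> x)) / sinh (r (\<iota> x))"
  shows "0 < descartes 1 k"
    and "hyperbolic_solid_angle (edge_length r) W (\<iota> a) =
      2 * pi + 2 * (face_angle 1 k a - sum (face_angle 1 k) UNIV)"
proof -
  define s where "s x = sinh (r (\<iota> x))" for x
  have s: "0 < s x" for x using r by (simp add: s_def)
  have ck: "cosh (r (\<iota> x)) = s x * k x" for x using s[of x] by (simp add: k_def s_def)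
  have s2: "(s x)\<^sup>2 * ((k x)\<^sup>2 - 1) = 1" for x
    using hyperbolic_pythagoras[of "r (\<iota> x)"] by (simp add: ck s_def[symmetric] power_mult_distrib algebra_simps)
  have kpos: "0 < k x" for x using r by (simp add: k_def)
  have k1: "1 < (k x)\<^sup>2" for x
    using s2[of x] s[of x] zero_less_mult_pos[of "(s x)\<^sup>2" "(k x)\<^sup>2 - 1"] by simp
  have W: "W = range \<iota>" and inj: "inj \<iota>" using \<iota> by (auto simp: bij_betw_def)
  define P where "P x = p (\<iota> x)" for x
  have P: "P x \<in> hyperbolic_space" for x
    using p by (auto simp: hyperbolic_tetrahedron_def W P_def)
  have PP: "lorentz (P x) (P x) = -1" for x using P[of x] by (simp add: hyperbolic_space_def)
  have dist: "lorentz (P x) (P y) = - s x * s y * (k x * k y + 1)" if "x \<noteq> y" for x y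
  proof -
    have "arcosh (- lorentz (P x) (P y)) = r (\<iota> x) + r (\<iota> y)"
      using p that injD[OF inj, of x y]
      by (auto simp: hyperbolic_tetrahedron_def hyperbolic_dist_def edge_length_def W P_def)
    then have "- lorentz (P x) (P y) = cosh (r (\<iota> x) + r (\<iota> y))"
      using cosh_arcosh_real[OF lorentz_le[OF P P], of x y] by simp
    also have "\<dots> = s x * s y * (k x * k y + 1)"
      unfolding cosh_add ck by (simp add: s_def[symmetric] algebra_simps)
    finally show ?thesis by simp
  qed
  define u where "u a x = hyperbolic_direction (P a) (P x)" for a x
  have gram: "lorentz (u a x) (u a y) = lorentz (P x) (P y) + lorentz (P a) (P x) * lorentz (P a) (P y)" for a x y
    unfolding u_def hyperbolic_direction_def using bilinear_lorentz
    by (simp add: bilinear_ladd bilinear_radd bilinear_lmul bilinear_rmul PP lorentz_commute[of "P x" "P a"])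
  have tangent: "lorentz (u a x) (P a) = 0" for a x
    unfolding u_def hyperbolic_direction_def using bilinear_lorentz
    by (simp add: bilinear_ladd bilinear_lmul PP lorentz_commute[of "P x" "P a"])
  have cone: "packed_cone lorentz (u a) (\<lambda>x. s a * s x) k 1 a" for a
  proof
    show "bilinear lorentz" by (rule bilinear_lorentz)
    show "lorentz x y = lorentz y x" for x y by (rule lorentz_commute)
    fix x assume "x \<noteq> a"
    then have "lorentz (u a x) (u a x) = (s a * s x * (k a * k x + 1))\<^sup>2 - 1"
      unfolding gram by (simp add: PP dist power2_eq_square)
    \<comment> \<open>Replacing 1 by a product of two factors of the form
      \<open>(s i)\<^sup>2 * ((k i)\<^sup>2 - 1)\<close> leaves a polynomial identity from which the
      squares of \<open>s a\<close> and \<open>s x\<close> factor out.\<close>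
    also have "\<dots> = (s a * s x * (k a * k x + 1))\<^sup>2 - ((s a)\<^sup>2 * ((k a)\<^sup>2 - 1)) * ((s x)\<^sup>2 * ((k x)\<^sup>2 - 1))"
      unfolding s2 by simp
    also have "\<dots> = (s a * s x)\<^sup>2 * (k a + k x)\<^sup>2"
      by (simp add: power2_eq_square algebra_simps)
    finally show "lorentz (u a x) (u a x) = (s a * s x)\<^sup>2 * (k a + k x)\<^sup>2" .
  next
    fix x y z assume d: "distinct [a, x, y, z]"
    then have "lorentz (u a x) (u a y) = (s a)\<^sup>2 * s x * s y * (k a * k x + 1) * (k a * k y + 1)
        - 1 * (s x * s y * (k x * k y + 1))"
      unfolding gram by (simp add: dist power2_eq_square)
    also have "\<dots> = (s a)\<^sup>2 * s x * s y * (k a * k x + 1) * (k a * k y + 1)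
        - ((s a)\<^sup>2 * ((k a)\<^sup>2 - 1)) * (s x * s y * (k x * k y + 1))"
      unfolding s2 ..
    also have "\<dots>
      = s a * s x * (s a * s y) * (face_curv 1 k z - ((k a)\<^sup>2 - 1))"
      unfolding face_curv_distinct4[OF d] by (simp add: power2_eq_square algebra_simps)
    finally show "lorentz (u a x) (u a y) = s a * s x * (s a * s y) * (face_curv 1 k z - ((k a)\<^sup>2 - 1))" .
  qed (simp_all add: kpos s k1)
  show pos: "0 < descartes 1 k"
  proof -
    have "inj (p \<circ> \<iota>)"
      using p inj by (intro comp_inj_on) (auto simp: hyperbolic_tetrahedron_def W)
    then have pne: "P x \<noteq> P y" if "x \<noteq> y" for x y using that by (auto simp: P_def inj_def)
    have pW: "p ` W = {P 1, P 2, P 3, P 4}" unfolding W UNIV_4 P_def by auto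
    then have ind: "independent {P 1, P 2, P 3, P 4}"
      using p unfolding pW[symmetric] by (simp add: hyperbolic_tetrahedron_def)
    show ?thesis
    proof (rule packed_cone.descartes_pos[OF cone[of 1], of 2 3 4])
      fix x y z :: real assume xy: "x \<noteq> 0 \<or> y \<noteq> 0"
      define w where "w = x *\<^sub>R u 1 3 + y *\<^sub>R u 1 4 + z *\<^sub>R u 1 2"
      have "w \<noteq> 0"
      proof
        assume 0: "w = 0"
        \<comment> \<open>The coefficient of \<open>P 1\<close> once the three projected directions
          are expanded in the \<open>P i\<close>.\<close>
        define t where "t = x * lorentz (P 1) (P 3) + y * lorentz (P 1) (P 4) + z * lorentz (P 1) (P 2)"
        define f where "f v = (if v = P 3 then x else if v = P 4 then y else if v = P 2 then z else t)" for v
        have "(\<Sum>v\<in>{P 1, P 2, P 3, P 4}. f v *\<^sub>R v) = 0"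
          using 0 by (simp add: f_def pne w_def u_def hyperbolic_direction_def t_def algebra_simps)
        then have "\<forall>v\<in>{P 1, P 2, P 3, P 4}. f v = 0"
          using ind by (subst (asm) independent_explicit_finite_subsets) auto
        then show False using xy by (auto simp: f_def pne)
      qed
      moreover have "lorentz w (P 1) = 0"
        unfolding w_def using bilinear_lorentz by (simp add: bilinear_ladd bilinear_lmul tangent)
      ultimately show "0 < lorentz w w" by (intro lorentz_tangent_pos[OF P])
    qed simp
  qed
  obtain b c d where d: "distinct [a, b, c, d]" by (rule distinct4_exists)
  have "W = {\<iota> a, \<iota> b, \<iota> c, \<iota> d}" "card W = 4"
    unfolding W using range_distinct4[OF d] card_image[OF inj] by simp_all
  then have "hyperbolic_solid_angle (edge_length r) W (\<iota> a) = cone_solid_angle lorentz (u a b) (u a c) (u a d)"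
    unfolding u_def P_def by (rule hyperbolic_solid_angle_eq[OF p])
  also have "\<dots> = 2 * pi + 2 * (face_angle 1 k a - sum (face_angle 1 k) UNIV)"
    by (rule packed_cone.cone_solid_angle_eq[OF cone d pos])
  finally show "hyperbolic_solid_angle (edge_length r) W (\<iota> a) =
      2 * pi + 2 * (face_angle 1 k a - sum (face_angle 1 k) UNIV)" .
qed

section \<open>Rigidity of a single tetrahedron\<close>

lemma solid_angle_variation:
  fixes \<alpha> \<alpha>' r r' :: "'v \<Rightarrow> real" and \<phi> \<phi>' :: "4 \<Rightarrow> real"
  assumes \<iota>: "bij_betw \<iota> UNIV W"
    and \<alpha>: "\<And>a. \<alpha> (\<iota> a) = 2 * pi + 2 * (\<phi> a - sum \<phi> UNIV)"
    and \<alpha>': "\<And>a. \<alpha>' (\<iota> a) = 2 * pi + 2 * (\<phi>' a - sum \<phi>' UNIV)"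
  defines "v \<equiv> \<lambda>a. r' (\<iota> a) - r (\<iota> a)"
  shows "(\<Sum>i\<in>W. (\<alpha>' i - \<alpha> i) * (r' i - r i)) = - 2 * (\<Sum>l\<in>UNIV. (\<phi>' l - \<phi> l) * (sum v UNIV - v l))"
proof -
  have "(\<Sum>i\<in>W. (\<alpha>' i - \<alpha> i) * (r' i - r i)) = (\<Sum>a\<in>UNIV. (\<alpha>' (\<iota> a) - \<alpha> (\<iota> a)) * v a)"
    unfolding v_def by (rule sum.reindex_bij_betw[OF \<iota>, symmetric])
  also have "\<dots> = (\<Sum>a\<in>UNIV. 2 * ((\<phi>' a - \<phi> a) * v a) - 2 * ((sum \<phi>' UNIV - sum \<phi> UNIV) * v a))"
    unfolding \<alpha> \<alpha>' by (rule sum.cong) (simp_all add: algebra_simps)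
  also have "\<dots> = 2 * (\<Sum>a\<in>UNIV. (\<phi>' a - \<phi> a) * v a) - 2 * ((\<Sum>a\<in>UNIV. \<phi>' a - \<phi> a) * sum v UNIV)"
    unfolding sum_subtractf sum_distrib_left[symmetric] ..
  \<comment> \<open>Regrouped by faces, each angle change meets the total radius change of the
    vertices of its face.\<close>
  also have "\<dots> = - 2 * (\<Sum>l\<in>UNIV. (\<phi>' l - \<phi> l) * (sum v UNIV - v l))"
    unfolding right_diff_distrib sum_subtractf[of "\<lambda>l. _ l * _"] sum_distrib_right[symmetric] by simp
  finally show ?thesis .
qed

lemma bij_betw_4:
  assumes "card W = 4"
  obtains \<iota> :: "4 \<Rightarrow> 'v" where "bij_betw \<iota> UNIV W"
proof -
  have "finite W" using assms by (metis card.infinite zero_neq_numeral)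
  then show ?thesis
    using finite_same_card_bij[of "UNIV :: 4 set" W] assms that by auto
qed

lemma euclidean_tetrahedron_rigid:
  assumes W: "card W = 4"
    and p: "euclidean_tetrahedron (edge_length r) W p" and r: "\<And>i. i \<in> W \<Longrightarrow> 0 < r i"
    and p': "euclidean_tetrahedron (edge_length r') W p'" and r': "\<And>i. i \<in> W \<Longrightarrow> 0 < r' i"
  defines "D \<equiv> (\<Sum>i\<in>W. (euclidean_solid_angle (edge_length r') W i - euclidean_solid_angle (edge_length r) W i)
      * (r' i - r i))"
  shows "D \<le> 0" and "D = 0 \<Longrightarrow> \<exists>c>0. \<forall>i\<in>W. r' i = c * r i"
proof -
  obtain \<iota> :: "4 \<Rightarrow> 'a" where \<iota>: "bij_betw \<iota> UNIV W" using bij_betw_4[OF W] by blast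
  have \<iota>W: "\<iota> x \<in> W" for x using \<iota> by (auto simp: bij_betw_def)
  have pos: "0 < r (\<iota> x)" "0 < r' (\<iota> x)" for x using r r' \<iota>W by auto
  define v where "v = (\<lambda>a. r' (\<iota> a) - r (\<iota> a))"
  have f: "sqrt 0 < 1 / x" if "0 < x" for x :: real using that by simp
  have f': "((\<lambda>x. 1 / x) has_real_derivative - ((1 / x)\<^sup>2 - 0)) (at x)" if "0 < x" for x :: real
    using that by (auto intro!: derivative_eq_intros simp: power2_eq_square)
  note mono = face_angle_monotone[OF order.refl f f' pos euclidean_packed_tetrahedron(1)[OF p \<iota> pos(1)]]
  have D: "D = - 2 * (\<Sum>l\<in>UNIV. (face_angle 0 (\<lambda>x. 1 / r' (\<iota> x)) l - face_angle 0 (\<lambda>x. 1 / r (\<iota> x)) l) * (sum v UNIV - v l))"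
    unfolding D_def v_def
    by (rule solid_angle_variation[OF \<iota> euclidean_packed_tetrahedron(2)[OF p \<iota> pos(1)]
          euclidean_packed_tetrahedron(2)[OF p' \<iota> pos(2)]])
  show "D \<le> 0" using mono(1) unfolding D v_def by simp
  show "\<exists>c>0. \<forall>i\<in>W. r' i = c * r i" if "D = 0"
  proof -
    have "hess 0 (\<lambda>x. 1 / r (\<iota> x)) v v = 0" using mono(2) that unfolding D v_def by simp
    then obtain c where c: "\<And>l. ((1 / r (\<iota> l))\<^sup>2 - 0) * v l = c * (1 / r (\<iota> l))"
      using hess_eq_0_imp[of 0 "\<lambda>x. 1 / r (\<iota> x)" v] euclidean_packed_tetrahedron(1)[OF p \<iota> pos(1)] pos(1)
      by auto
    \<comment> \<open>The null vector \<open>v\<close>, the difference of the radii, is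
      \<open>c\<close> times the old radii, whence the factor \<open>1 + c\<close>; it is positive
      as a ratio of radii.\<close>
    have rc: "r' (\<iota> l) = (1 + c) * r (\<iota> l)" for l
    proof -
      have "r (\<iota> l) * r' (\<iota> l) = r (\<iota> l) * ((1 + c) * r (\<iota> l))"
        using c[of l] pos(1)[of l] by (simp add: v_def field_simps power2_eq_square)
      then show ?thesis using pos(1)[of l] by simp
    qed
    have "0 < 1 + c" using rc[of 1] pos[of 1] by (simp add: zero_less_mult_iff)
    moreover have "\<forall>i\<in>W. r' i = (1 + c) * r i"
      using rc \<iota> by (auto simp: bij_betw_def)
    ultimately show ?thesis by blast
  qed
qed

lemma hyperbolic_tetrahedron_rigid:
  assumes W: "card W = 4"
    and p: "hyperbolic_tetrahedron (edge_length r) W p" and r: "\<And>i. i \<in> W \<Longrightarrow> 0 < r i"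
    and p': "hyperbolic_tetrahedron (edge_length r') W p'" and r': "\<And>i. i \<in> W \<Longrightarrow> 0 < r' i"
  defines "D \<equiv> (\<Sum>i\<in>W. (hyperbolic_solid_angle (edge_length r') W i - hyperbolic_solid_angle (edge_length r) W i)
      * (r' i - r i))"
  shows "D \<le> 0" and "D = 0 \<Longrightarrow> \<forall>i\<in>W. r' i = r i"
proof -
  obtain \<iota> :: "4 \<Rightarrow> 'a" where \<iota>: "bij_betw \<iota> UNIV W" using bij_betw_4[OF W] by blast
  have \<iota>W: "\<iota> x \<in> W" for x using \<iota> by (auto simp: bij_betw_def)
  have pos: "0 < r (\<iota> x)" "0 < r' (\<iota> x)" for x using r r' \<iota>W by auto
  define v where "v = (\<lambda>a. r' (\<iota> a) - r (\<iota> a))"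
  define k where "k x = cosh x / sinh x" for x :: real
  have f: "sqrt 1 < k x" if "0 < x" for x
    using that sinh_less_cosh_real[of x] by (simp add: k_def)
  have f': "(k has_real_derivative - ((k x)\<^sup>2 - 1)) (at x)" if "0 < x" for x :: real
    unfolding k_def using that
    by (auto intro!: derivative_eq_intros simp: field_simps power2_eq_square)
  have e: "(0::real) \<le> 1" by simp
  have Q: "0 < descartes 1 (\<lambda>x. k (r (\<iota> x)))"
    unfolding k_def by (rule hyperbolic_packed_tetrahedron(1)[OF p \<iota> pos(1)])
  note mono = face_angle_monotone[OF e f f' pos Q]
  have D: "D = - 2 * (\<Sum>l\<in>UNIV. (face_angle 1 (\<lambda>x. k (r' (\<iota> x))) l - face_angle 1 (\<lambda>x. k (r (\<iota> x))) l) * (sum v UNIV - v l))"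
    unfolding D_def v_def k_def
    by (rule solid_angle_variation[OF \<iota> hyperbolic_packed_tetrahedron(2)[OF p \<iota> pos(1)]
          hyperbolic_packed_tetrahedron(2)[OF p' \<iota> pos(2)]])
  show "D \<le> 0" using mono(1) unfolding D v_def by simp
  show "\<forall>i\<in>W. r' i = r i" if "D = 0"
  proof -
    have h: "hess 1 (\<lambda>x. k (r (\<iota> x))) v v = 0" using mono(2) that unfolding D v_def by simp
    obtain c where c: "\<And>l. ((k (r (\<iota> l)))\<^sup>2 - 1) * v l = c * k (r (\<iota> l))" "1 * c = 0"
      by (rule hess_eq_0_imp[OF e f[OF pos(1)] Q h]) (rule that)
    have "v l = 0" for l
      using c(1)[of l] c(2) sqrt_less_imp_less_power2[OF e f[OF pos(1)[of l]]] by simp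
    then show ?thesis using \<iota> by (auto simp: bij_betw_def v_def)
  qed
qed

section \<open>Triangulated 3-manifolds\<close>

lemma simplicial_complexD:
  assumes "simplicial_complex C"
  shows "finite C" "S \<in> C \<Longrightarrow> \<exists>n. n simplex S" "S \<in> C \<Longrightarrow> F face_of S \<Longrightarrow> F \<in> C"
    "S \<in> C \<Longrightarrow> T \<in> C \<Longrightarrow> S \<inter> T face_of S"
  using assms unfolding simplicial_complex_def by blast+

lemma finite_vertices:
  assumes "simplicial_complex C"
  shows "finite (vertices C)"
proof (rule finite_subset)
  show "vertices C \<subseteq> the_elem ` C" by (force simp: vertices_def image_iff)
qed (use simplicial_complexD(1)[OF assms] in simp)

lemma finite_tetrahedra:
  assumes "simplicial_complex C"
  shows "finite (tetrahedra C)"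
proof -
  have "tetrahedra C \<subseteq> (\<lambda>S. {v. v extreme_point_of S}) ` C" by (auto simp: tetrahedra_def)
  then show ?thesis using simplicial_complexD(1)[OF assms] by (rule finite_surj[rotated])
qed

lemma tetrahedra_card:
  assumes "W \<in> tetrahedra C"
  shows "card W = 4"
proof -
  obtain S where S: "3 simplex S" "W = {v. v extreme_point_of S}"
    using assms by (auto simp: tetrahedra_def)
  then obtain D where "\<not> affine_dependent D" "int (card D) = 3 + 1" "S = convex hull D"
    by (auto simp: simplex_def)
  then have "W = D" "card D = 4" using S(2) extreme_point_of_convex_hull_affine_independent[of D] by auto
  then show ?thesis by simp
qed

lemma tetrahedra_subset_vertices:
  assumes "simplicial_complex C" "W \<in> tetrahedra C"
  shows "W \<subseteq> vertices C"
proof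
  fix v assume "v \<in> W"
  then obtain S where "S \<in> C" "v extreme_point_of S" using assms(2) by (auto simp: tetrahedra_def)
  then show "v \<in> vertices C"
    using simplicial_complexD(3)[OF assms(1)] by (auto simp: vertices_def face_of_singleton)
qed

text \<open>Any other simplex meets the maximal simplex \<open>T\<close> in a proper face, which
  misses the relative interior; the union of the others is closed, being finite, and can be
  removed.\<close>

lemma rel_interior_maximal_simplex_openin:
  assumes C: "simplicial_complex C" and T: "T \<in> C"
    and max: "\<And>S. S \<in> C \<Longrightarrow> T \<subseteq> S \<Longrightarrow> S = T"
  shows "openin (top_of_set (\<Union>C)) (rel_interior T)"
proof -
  define R where "R = \<Union>(C - {T})"
  have "closed R"
    unfolding R_def using simplicial_complexD(1,2)[OF C] closed_simplex
    by (intro closed_Union) auto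
  have disj: "rel_interior T \<inter> R = {}"
  proof (rule ccontr)
    assume "rel_interior T \<inter> R \<noteq> {}"
    then obtain x S where x: "x \<in> rel_interior T" "S \<in> C" "S \<noteq> T" "x \<in> S" by (auto simp: R_def)
    have "T \<inter> S \<noteq> T" using max[OF x(2)] x(3) by blast
    then have "(T \<inter> S) \<inter> rel_interior T = {}"
      by (rule face_of_disjoint_rel_interior[OF simplicial_complexD(4)[OF C T x(2)]])
    then show False using x rel_interior_subset by auto
  qed
  have "openin (top_of_set T) (rel_interior T)"
    using openin_rel_interior by (rule openin_subset_trans) (auto simp: rel_interior_subset hull_subset)
  then obtain O' where O': "open O'" "rel_interior T = T \<inter> O'" by (auto simp: openin_open)
  have "rel_interior T = \<Union>C \<inter> (O' \<inter> - R)"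
    using O'(2) disj T by (auto simp: R_def)
  then show ?thesis
    using O'(1) \<open>closed R\<close> by (auto simp: openin_open intro!: exI[of _ "O' \<inter> - R"])
qed

text \<open>A chart composed with \<open>h\<close> carries a nonempty relatively open part of
  \<open>A\<close> homeomorphically onto an open subset of \<open>real^3\<close>; invariance of
  dimension, applied in both directions, gives equality.\<close>

lemma euclidean_neighbourhood_aff_dim:
  fixes X :: "'v::euclidean_space set"
  assumes M: "closed_3_manifold M" and h: "homeomorphic_map (top_of_set X) M h"
    and R: "openin (top_of_set X) R" "openin (top_of_set A) R" "affine A" "R \<noteq> {}"
  shows "aff_dim A = 3"
proof -
  obtain x where x: "x \<in> R" using R(4) by blast
  have RX: "R \<subseteq> X" using openin_imp_subset[OF R(1)] .
  have hX: "h ` X = topspace M" using homeomorphic_imp_surjective_map[OF h] by simp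
  then have "h x \<in> topspace M" using x RX by auto
  then obtain U and B :: "(real^3) set" where U: "openin M U" "h x \<in> U" and B: "open B"
    and "subtopology M U homeomorphic_space top_of_set B"
    using M unfolding closed_3_manifold_def by meson
  then obtain f where f: "homeomorphic_map (subtopology M U) (top_of_set B) f"
    unfolding homeomorphic_space by blast
  define N where "N = {z \<in> X. h z \<in> U} \<inter> R"
  have N: "openin (top_of_set X) N"
  proof -
    have "continuous_map (top_of_set X) M h" using h by (rule homeomorphic_imp_continuous_map)
    then have "openin (top_of_set X) {z \<in> topspace (top_of_set X). h z \<in> U}"
      using U(1) by (rule openin_continuous_map_preimage)
    then show ?thesis unfolding N_def using R(1) by (simp add: openin_Int)
  qed
  have "N \<subseteq> R" "x \<in> N" using x RX U(2) by (auto simp: N_def)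
  have "openin (top_of_set R) N" by (rule openin_subset_trans[OF N \<open>N \<subseteq> R\<close> RX])
  then have NA: "openin (top_of_set A) N" using R(2) by (rule openin_trans)
  have hN: "openin M (h ` N)" "h ` N \<subseteq> U"
    using homeomorphic_imp_open_map[OF h] N by (auto simp: open_map_def N_def)
  define G where "G = f ` h ` N"
  have "openin (subtopology M U) (h ` N)" using hN by (simp add: openin_subtopology_alt) blast
  then have "openin (top_of_set B) G"
    unfolding G_def using homeomorphic_imp_open_map[OF f] by (simp add: open_map_def)
  then have "open G" using B by (simp add: openin_open_eq)
  have "homeomorphic_map (subtopology (top_of_set X) N) (subtopology M (h ` N)) h"
    by (rule homeomorphic_map_subtopologies[OF h])
      (use N hX in \<open>auto simp: N_def\<close>)
  moreover have "homeomorphic_map (subtopology (subtopology M U) (h ` N)) (subtopology (top_of_set B) G) f"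
  proof (rule homeomorphic_map_subtopologies[OF f])
    have "topspace (subtopology M U) \<inter> h ` N = h ` N" using hN openin_subset[OF hN(1)] by auto
    moreover have "topspace (top_of_set B) \<inter> G = G"
      using openin_imp_subset[OF \<open>openin (top_of_set B) G\<close>] by auto
    ultimately show "f ` (topspace (subtopology M U) \<inter> h ` N) = topspace (top_of_set B) \<inter> G"
      by (simp add: G_def)
  qed
  moreover have "subtopology (top_of_set X) N = top_of_set N"
    using openin_imp_subset[OF N] by (simp add: subtopology_subtopology Int_absorb1)
  moreover have "subtopology (subtopology M U) (h ` N) = subtopology M (h ` N)"
    using hN(2) by (simp add: subtopology_subtopology Int_absorb1)
  moreover have "subtopology (top_of_set B) G = top_of_set G"
    using openin_imp_subset[OF \<open>openin (top_of_set B) G\<close>] by (simp add: subtopology_subtopology Int_absorb1)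
  ultimately have "homeomorphic_map (top_of_set N) (top_of_set G) (f \<circ> h)"
    using homeomorphic_map_compose by metis
  then obtain g where "homeomorphic_maps (top_of_set N) (top_of_set G) (f \<circ> h) g"
    unfolding homeomorphic_map_maps by blast
  then have fg: "continuous_on N (f \<circ> h)" "continuous_on G g" "g ` G \<subseteq> N"
    "\<And>z. z \<in> N \<Longrightarrow> g ((f \<circ> h) z) = z" "\<And>z. z \<in> G \<Longrightarrow> (f \<circ> h) (g z) = z"
    by (auto simp: homeomorphic_maps_def)
  have inj: "inj_on (f \<circ> h) N" using fg(4) by (rule inj_on_inverseI)
  have "aff_dim A \<le> aff_dim (UNIV :: (real^3) set)"
    by (rule invariance_of_dimension_affine_sets[OF NA R(3) affine_UNIV fg(1) _ inj]) (use \<open>x \<in> N\<close> in auto)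
  moreover have "aff_dim (UNIV :: (real^3) set) \<le> aff_dim A"
  proof (rule invariance_of_dimension_affine_sets[OF _ affine_UNIV R(3), of G g])
    show "openin (top_of_set UNIV) G" using \<open>open G\<close> by simp
    show "g \<in> G \<rightarrow> A" using fg(3) openin_imp_subset[OF NA] by auto
    show "inj_on g G" using fg(5) by (rule inj_on_inverseI)
    show "G \<noteq> {}" using \<open>x \<in> N\<close> by (auto simp: G_def)
  qed (rule fg(2))
  ultimately show ?thesis by (simp add: aff_dim_UNIV)
qed

text \<open>A maximal simplex containing \<open>S\<close> has its relative interior open in the
  polyhedron, so its dimension is that of the manifold.\<close>

lemma simplex_subset_tetrahedron:
  assumes M: "closed_3_manifold M" and C: "triangulates C h M" and S: "S \<in> C" "S \<noteq> {}"
  obtains T where "T \<in> C" "3 simplex T" "S \<subseteq> T"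
proof -
  have sc: "simplicial_complex C" and h: "homeomorphic_map (top_of_set (\<Union>C)) M h"
    using C by (auto simp: triangulates_def)
  obtain T where T: "T \<in> C" "S \<subseteq> T" "\<And>S'. S' \<in> C \<Longrightarrow> T \<subseteq> S' \<Longrightarrow> S' = T"
    using finite_has_maximal2[OF simplicial_complexD(1)[OF sc] S(1)] by metis
  obtain n where n: "n simplex T" using simplicial_complexD(2)[OF sc T(1)] by blast
  have "rel_interior T \<noteq> {}"
    using convex_simplex[OF n] S(2) T(2) by (auto simp: rel_interior_eq_empty)
  then have "aff_dim (affine hull T) = 3"
    by (intro euclidean_neighbourhood_aff_dim[OF M h rel_interior_maximal_simplex_openin[OF sc T(1,3)] openin_rel_interior]) auto
  then have "n = 3" using aff_dim_simplex[OF n] by simp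
  then show ?thesis using that T n by blast
qed

lemma vertex_in_tetrahedron:
  assumes M: "closed_3_manifold M" and C: "triangulates C h M" and v: "v \<in> vertices C"
  obtains W where "W \<in> tetrahedra C" "v \<in> W"
proof -
  have vC: "{v} \<in> C" using v by (simp add: vertices_def)
  obtain T where T: "T \<in> C" "3 simplex T" "{v} \<subseteq> T"
    using simplex_subset_tetrahedron[OF M C vC] by auto
  have "T \<inter> {v} face_of T" using C T(1) vC by (intro simplicial_complexD(4)) (auto simp: triangulates_def)
  then have "v extreme_point_of T" using T(3) by (simp add: face_of_singleton Int_absorb1)
  then show ?thesis using that T by (auto simp: tetrahedra_def)
qed

text \<open>The tetrahedra with all vertices in \<open>A\<close> and those with none cover the
  polyhedron by two closed sets. These are disjoint because two simplices that meet share a vertex,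
  so connectedness leaves one of them empty.\<close>

lemma vertices_connected:
  fixes C :: "'v::euclidean_space set set"
  assumes M: "closed_3_manifold M" "connected_space M" and C: "triangulates C h M"
    and A: "\<And>W. W \<in> tetrahedra C \<Longrightarrow> W \<inter> A \<noteq> {} \<Longrightarrow> W \<subseteq> A"
    and v: "v \<in> vertices C" "v \<in> A"
  shows "vertices C \<subseteq> A"
proof
  fix w assume w: "w \<in> vertices C"
  have sc: "simplicial_complex C" and h: "homeomorphic_map (top_of_set (\<Union>C)) M h"
    using C by (auto simp: triangulates_def)
  define ext where "ext T = {v. v extreme_point_of T}" for T :: "'v set"
  have extW: "ext T \<in> tetrahedra C" if "T \<in> C" "3 simplex T" for T
    using that by (auto simp: ext_def tetrahedra_def)
  define P where "P = {T \<in> C. 3 simplex T \<and> ext T \<subseteq> A}"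
  define N where "N = {T \<in> C. 3 simplex T \<and> ext T \<inter> A = {}}"
  have fin: "finite P" "finite N" using simplicial_complexD(1)[OF sc] by (auto simp: P_def N_def)
  have cl: "closed (\<Union>P)" "closed (\<Union>N)"
    using fin closed_simplex by (auto intro!: closed_Union simp: P_def N_def)
  have "connected (\<Union>C)"
    using homeomorphic_connected_space[OF homeomorphic_map_imp_homeomorphic_space[OF h]] M(2)
    by (simp add: connectedin_def flip: connectedin_iff_connected)
  moreover have "\<Union>C \<subseteq> \<Union>P \<union> \<Union>N"
  proof
    fix x assume "x \<in> \<Union>C"
    then obtain S where S: "S \<in> C" "x \<in> S" by blast
    then obtain T where T: "T \<in> C" "3 simplex T" "S \<subseteq> T"
      using simplex_subset_tetrahedron[OF M(1) C S(1)] by auto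
    then show "x \<in> \<Union>P \<union> \<Union>N" using A[OF extW[OF T(1,2)]] S(2) by (auto simp: P_def N_def)
  qed
  moreover have "\<Union>P \<inter> \<Union>N \<inter> \<Union>C = {}"
  proof (rule ccontr)
    assume "\<Union>P \<inter> \<Union>N \<inter> \<Union>C \<noteq> {}"
    then obtain x S T where x: "S \<in> P" "T \<in> N" "x \<in> S \<inter> T" by blast
    have ST: "S \<in> C" "3 simplex S" "T \<in> C" "3 simplex T" using x by (auto simp: P_def N_def)
    have "compact (S \<inter> T)" "convex (S \<inter> T)"
      using ST by (auto intro: compact_Int compact_simplex convex_Int convex_simplex)
    \<comment> \<open>The intersection is a face of both tetrahedra, so an extreme point of it is a
      vertex of both.\<close>
    then obtain y where y: "y extreme_point_of (S \<inter> T)" using extreme_point_exists_convex x(3) by blast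
    have "y extreme_point_of S" "y extreme_point_of T"
      using extreme_point_of_face[OF simplicial_complexD(4)[OF sc ST(1,3)], of y]
        extreme_point_of_face[OF simplicial_complexD(4)[OF sc ST(3,1)], of y] y by (auto simp: Int_commute)
    then show False using x(1,2) by (auto simp: P_def N_def ext_def)
  qed
  ultimately have "\<Union>P \<inter> \<Union>C = {} \<or> \<Union>N \<inter> \<Union>C = {}" using cl by (intro connected_closedD) auto
  moreover have "\<exists>T\<in>C. 3 simplex T \<and> u \<in> ext T \<and> u \<in> T" if u: "u \<in> vertices C" for u
  proof -
    obtain W where "W \<in> tetrahedra C" "u \<in> W" using vertex_in_tetrahedron[OF M(1) C u] by blast
    then show ?thesis by (auto simp: tetrahedra_def ext_def extreme_point_of_def)
  qed
  then obtain S T where S: "S \<in> C" "3 simplex S" "v \<in> ext S" "v \<in> S"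
    and T: "T \<in> C" "3 simplex T" "w \<in> ext T" "w \<in> T" using v(1) w by metis
  have "S \<in> P" using A[OF extW[OF S(1,2)]] S v(2) by (auto simp: P_def)
  ultimately have "\<Union>N \<inter> \<Union>C = {}" using S(1,4) by blast
  then have "T \<notin> N" using T(1,4) by blast
  then show "w \<in> A" using A[OF extW[OF T(1,2)]] T by (auto simp: N_def)
qed

section \<open>Global rigidity\<close>

text \<open>Summing by parts over the tetrahedra: equal curvatures force every nonpositive
  single-tetrahedron term to vanish.\<close>

lemma tetrahedron_terms_zero:
  fixes C :: "'v::euclidean_space set set" and \<alpha> \<alpha>' :: "'v set \<Rightarrow> 'v \<Rightarrow> real" and r r' :: "'v \<Rightarrow> real"
  assumes C: "simplicial_complex C"
    and K: "\<And>i. i \<in> vertices C \<Longrightarrow>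
      (\<Sum>W | W \<in> tetrahedra C \<and> i \<in> W. \<alpha> W i) = (\<Sum>W | W \<in> tetrahedra C \<and> i \<in> W. \<alpha>' W i)"
    and le: "\<And>W. W \<in> tetrahedra C \<Longrightarrow> (\<Sum>i\<in>W. (\<alpha>' W i - \<alpha> W i) * (r' i - r i)) \<le> 0"
    and W: "W \<in> tetrahedra C"
  shows "(\<Sum>i\<in>W. (\<alpha>' W i - \<alpha> W i) * (r' i - r i)) = 0"
proof -
  define d where "d W i = (\<alpha>' W i - \<alpha> W i) * (r' i - r i)" for W i
  note fin = finite_vertices[OF C] finite_tetrahedra[OF C]
  have "(\<Sum>W\<in>tetrahedra C. \<Sum>i\<in>W. d W i) = (\<Sum>W\<in>tetrahedra C. \<Sum>i\<in>{i \<in> vertices C. i \<in> W}. d W i)"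
  proof (rule sum.cong)
    fix W assume "W \<in> tetrahedra C"
    then have "{i \<in> vertices C. i \<in> W} = W" using tetrahedra_subset_vertices[OF C] by blast
    then show "(\<Sum>i\<in>W. d W i) = (\<Sum>i\<in>{i \<in> vertices C. i \<in> W}. d W i)" by simp
  qed simp
  also have "\<dots> = (\<Sum>i\<in>vertices C. \<Sum>W\<in>{W \<in> tetrahedra C. i \<in> W}. d W i)"
    by (rule sum.swap_restrict[OF fin(2,1)])
  also have "\<dots> = (\<Sum>i\<in>vertices C. (\<Sum>W\<in>{W \<in> tetrahedra C. i \<in> W}. \<alpha>' W i - \<alpha> W i) * (r' i - r i))"
    by (simp add: d_def sum_distrib_right)
  also have "\<dots> = 0"
    using K by (intro sum.neutral) (simp add: sum_subtractf)
  finally have "(\<Sum>W\<in>tetrahedra C. - (\<Sum>i\<in>W. d W i)) = 0" by (simp add: sum_negf)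
  then have "\<forall>W\<in>tetrahedra C. - (\<Sum>i\<in>W. d W i) = 0"
    using le fin(2) by (subst (asm) sum_nonneg_eq_0_iff) (auto simp: d_def)
  then show ?thesis using W by (simp add: d_def)
qed

theorem theorem1p3:
  fixes M :: "'m topology" and C :: "'v::euclidean_space set set" and h :: "'v \<Rightarrow> 'm"
  assumes "closed_3_manifold M" and "connected_space M" and "triangulates C h M"
  shows "(\<forall>r r'. euclidean_sphere_packing_metric C r \<longrightarrow>
            euclidean_sphere_packing_metric C r' \<longrightarrow>
            (\<forall>i\<in>vertices C. euclidean_curvature C r i = euclidean_curvature C r' i) \<longrightarrow>
            (\<exists>c>0. \<forall>i\<in>vertices C. r' i = c * r i)) \<and>
         (\<forall>r r'. hyperbolic_sphere_packing_metric C r \<longrightarrow>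
            hyperbolic_sphere_packing_metric C r' \<longrightarrow>
            (\<forall>i\<in>vertices C. hyperbolic_curvature C r i = hyperbolic_curvature C r' i) \<longrightarrow>
            (\<forall>i\<in>vertices C. r i = r' i))"
proof (intro conjI allI impI)
  have sc: "simplicial_complex C" using assms(3) by (simp add: triangulates_def)
  note sub = tetrahedra_subset_vertices[OF sc]
  fix r r' :: "'v \<Rightarrow> real"
  {
    assume r: "euclidean_sphere_packing_metric C r" and r': "euclidean_sphere_packing_metric C r'"
      and K: "\<forall>i\<in>vertices C. euclidean_curvature C r i = euclidean_curvature C r' i"
    have pos: "0 < r i" "0 < r' i" if "i \<in> vertices C" for i
      using r r' that by (auto simp: euclidean_sphere_packing_metric_def)
    have rigid: "\<exists>c>0. \<forall>i\<in>W. r' i = c * r i" if W: "W \<in> tetrahedra C" for W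
    proof -
      have tet: "\<exists>p. euclidean_tetrahedron (edge_length r) W p" "\<exists>p. euclidean_tetrahedron (edge_length r') W p"
        if "W \<in> tetrahedra C" for W
        using r r' that by (auto simp: euclidean_sphere_packing_metric_def)
      have "(\<Sum>i\<in>W. (euclidean_solid_angle (edge_length r') W i - euclidean_solid_angle (edge_length r) W i) * (r' i - r i)) = 0"
      proof (rule tetrahedron_terms_zero[OF sc _ _ W])
        fix W assume W: "W \<in> tetrahedra C"
        obtain p p' where p: "euclidean_tetrahedron (edge_length r) W p" "euclidean_tetrahedron (edge_length r') W p'"
          using tet[OF W] by blast
        show "(\<Sum>i\<in>W. (euclidean_solid_angle (edge_length r') W i - euclidean_solid_angle (edge_length r) W i) * (r' i - r i)) \<le> 0"
          using pos sub[OF W]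
          by (intro euclidean_tetrahedron_rigid(1)[OF tetrahedra_card[OF W] p(1) _ p(2)]) auto
      qed (use K in \<open>simp add: euclidean_curvature_def\<close>)
      moreover obtain p p' where p: "euclidean_tetrahedron (edge_length r) W p" "euclidean_tetrahedron (edge_length r') W p'"
        using tet[OF W] by blast
      ultimately show ?thesis
        using pos sub[OF W]
        by (intro euclidean_tetrahedron_rigid(2)[OF tetrahedra_card[OF W] p(1) _ p(2)]) auto
    qed
    show "\<exists>c>0. \<forall>i\<in>vertices C. r' i = c * r i"
    proof (cases "vertices C = {}")
      case False
      then obtain v where v: "v \<in> vertices C" by blast
      define c where "c = r' v / r v"
      \<comment> \<open>The factor on a tetrahedron is determined by any one of its vertices, so the
        vertices with factor \<open>c\<close> satisfy the closure condition of
        \<open>vertices_connected\<close>.\<close>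
      have "vertices C \<subseteq> {i. r' i = c * r i}"
      proof (rule vertices_connected[OF assms _ v])
        fix W assume W: "W \<in> tetrahedra C" "W \<inter> {i. r' i = c * r i} \<noteq> {}"
        then obtain j where j: "j \<in> W" "r' j = c * r j" by blast
        obtain c' where c': "\<forall>i\<in>W. r' i = c' * r i" using rigid[OF W(1)] by blast
        have "0 < r j" using pos(1) sub[OF W(1)] j(1) by blast
        then have "c' = c" using c' j by auto
        then show "W \<subseteq> {i. r' i = c * r i}" using c' by blast
      next
        show "v \<in> {i. r' i = c * r i}" using pos(1)[OF v] by (simp add: c_def)
      qed
      moreover have "0 < c" using pos[OF v] by (simp add: c_def)
      ultimately show ?thesis by blast
    \<comment> \<open>With no vertices any positive constant serves.\<close>
    qed (auto intro: exI[of _ 1])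
  }
  {
    assume r: "hyperbolic_sphere_packing_metric C r" and r': "hyperbolic_sphere_packing_metric C r'"
      and K: "\<forall>i\<in>vertices C. hyperbolic_curvature C r i = hyperbolic_curvature C r' i"
    have pos: "0 < r i" "0 < r' i" if "i \<in> vertices C" for i
      using r r' that by (auto simp: hyperbolic_sphere_packing_metric_def)
    have rigid: "\<forall>i\<in>W. r' i = r i" if W: "W \<in> tetrahedra C" for W
    proof -
      have tet: "\<exists>p. hyperbolic_tetrahedron (edge_length r) W p" "\<exists>p. hyperbolic_tetrahedron (edge_length r') W p"
        if "W \<in> tetrahedra C" for W
        using r r' that by (auto simp: hyperbolic_sphere_packing_metric_def)
      have "(\<Sum>i\<in>W. (hyperbolic_solid_angle (edge_length r') W i - hyperbolic_solid_angle (edge_length r) W i) * (r' i - r i)) = 0"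
      proof (rule tetrahedron_terms_zero[OF sc _ _ W])
        fix W assume W: "W \<in> tetrahedra C"
        obtain p p' where p: "hyperbolic_tetrahedron (edge_length r) W p" "hyperbolic_tetrahedron (edge_length r') W p'"
          using tet[OF W] by blast
        show "(\<Sum>i\<in>W. (hyperbolic_solid_angle (edge_length r') W i - hyperbolic_solid_angle (edge_length r) W i) * (r' i - r i)) \<le> 0"
          using pos sub[OF W]
          by (intro hyperbolic_tetrahedron_rigid(1)[OF tetrahedra_card[OF W] p(1) _ p(2)]) auto
      qed (use K in \<open>simp add: hyperbolic_curvature_def\<close>)
      moreover obtain p p' where p: "hyperbolic_tetrahedron (edge_length r) W p" "hyperbolic_tetrahedron (edge_length r') W p'"
        using tet[OF W] by blast
      ultimately show ?thesis
        using pos sub[OF W]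
        by (intro hyperbolic_tetrahedron_rigid(2)[OF tetrahedra_card[OF W] p(1) _ p(2)]) auto
    qed
    show "\<forall>i\<in>vertices C. r i = r' i"
    proof
      fix i assume i: "i \<in> vertices C"
      obtain W where "W \<in> tetrahedra C" "i \<in> W"
        using vertex_in_tetrahedron[OF assms(1,3) i] by blast
      then show "r i = r' i" using rigid by auto
    qed
  }
qed

end
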